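(* Let $s\in\mathbb{Z}_{\ge1}$ and let $\widetilde{\mathcal{T}}_n^{m}(u)$ be the normalized functions associated with $B(0|s)$ and the rectangular Young diagram with $m$ rows and $n$ columns, as defined in the context. Set $T_m^{(a)}(u)=\widetilde{\mathcal{T}}_a^{m}(u)$ for $a\in\{1,\dots,s-1\}$, $T_{2m}^{(s)}(u)=\widetilde{\mathcal{T}}_s^{m}(u)$ for $m\in\mathbb{Z}_{\ge1}$, and $T_0^{(a)}(u)=T_0^{(s)}(u)=T_m^{(0)}(u)=1$. Then for all $m\in\mathbb{Z}_{\ge1}$ (the first two relations being present only for $s\ge 3$ and $s\ge2$, respectively): $$T_m^{(a)}(u-1)T_m^{(a)}(u+1)=T_{m-1}^{(a)}(u)T_{m+1}^{(a)}(u)+g_m^{(a)}(u)T_m^{(a-1)}(u)T_m^{(a+1)}(u)\quad(1\le a\le s-2),$$ $$T_m^{(s-1)}(u-1)T_m^{(s-1)}(u+1)=T_{m-1}^{(s-1)}(u)T_{m+1}^{(s-1)}(u)+g_m^{(s-1)}(u)T_m^{(s-2)}(u)T_{2m}^{(s)}(u),$$ $$T_{2m}^{(s)}(u-1)T_{2m}^{(s)}(u+1)=T_{2m-2}^{(s)}(u)T_{2m+2}^{(s)}(u)+g_{2m}^{(s)}(u)T_m^{(s-1)}(u)T_{2m}^{(s)}(u),$$ where, with $\widetilde{\mathcal{T}}_0(u)=\phi(u+1)\phi(u-2s-2)$: if $s\ge2$, $g_m^{(b)}(u)=\big\{\prod_{j=1}^m\widetilde{\mathcal{T}}_0(u+2j-m-1)\big\}^{\delta_{b,1}}$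 (so in particular $g_{2m}^{(s)}(u)=1$); if $s=1$, $g_{2m}^{(1)}(u)=\prod_{j=1}^m\widetilde{\mathcal{T}}_0(u+2j-m-1)$.
   Context: $\Phi$ is an entire function, not identically zero, with a zero at $u=0$ (e.g. $\Phi(u)=u$); $N,N_a\in\mathbb{Z}_{\ge0}$; $w_j,u_j^{(a)}\in\mathbb{C}$ are parameters; $Q_a(u)=\prod_{j=1}^{N_a}\Phi(u-u_j^{(a)})$ for $1\le a\le s$; $Q_0(u)=1$; $\phi(u)=\prod_{j=1}^N\Phi(u-w_j)$. Identities are between meromorphic functions of $u$. **Index set.** $J=\{1,\dots,s,0,\overline s,\dots,\overline1\}$ with total order $1\prec\cdots\prec s\prec0\prec\overline s\prec\cdots\prec\overline1$; $p(0)=0$ and $p(c)=1$ for $c\ne0$. **Box functions.** - $1\le a\le s$: $[a]_u=\psi_a(u)\frac{Q_{a-1}(u-a-1)Q_a(u-a+2)}{Q_{a-1}(u-a+1)Q_a(u-a)}$. - $[0]_u=\psi_0(u)\frac{Q_s(u-s+1)Q_s(u-s-2)}{Q_s(u-s-1)Q_s(u-s)}$. - $1\le a\le s$: $[\overline a]_u=\psi_{\overline a}(u)\frac{Q_{a-1}(u-2s+a)Q_a(u-2s+a-3)}{Q_{a-1}(u-2s+a-2)Q_a(u-2s+a-1)}$. Here $\psi_1(u)=\phi(u-2)\phi(u-2s-1)$, $\psi_{\overline1}(u)=\phi(u)\phi(u-2s+1)$, and $\psi_c(u)=\phi(u)\phi(u-2s-1)$ for all other $c\in J$. **Rectangular functions**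 ($m$ rows, $n$ columns; $m,n\ge1$): $$\mathcal{T}_n^m(u)=\sum_b\ \prod_{i=1}^m\prod_{j=1}^n(-1)^{p(b(i,j))}[b(i,j)]_{u-n+m-2i+2j},$$ the sum being over fillings $b(i,j)\in J$ ($1\le i\le m$ row, $1\le j\le n$ column) with $b(i,j)\prec b(i,j+1)$ and $b(i,j)\preceq b(i+1,j)$. **Normalization.** $\widetilde{\mathcal{T}}_n^m(u)=\mathcal{T}_n^m(u)\big/\prod_{j=1}^m\mathcal{F}_n(u+m-2j+1)$, where $$\mathcal{F}_n(u)=\prod_{j=1}^{n-1}\phi(u-n+2j+1)\,\phi(u-2s-n+2j-2)\quad(n\ge2),\qquad\mathcal{F}_1(u)=1.$$ *)

theory Defs
  imports "HOL-Complex_Analysis.Complex_Analysis"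
begin

text \<open>
  Throughout, \<open>s\<close> is the rank, \<open>\<phi>\<close> the vacuum function and \<open>Q a\<close> the Baxter-type function of
  colour \<open>a\<close> (with \<open>Q 0 = 1\<close>). Functions defined by quotients are only meaningful as meromorphic
  functions: at zeros of a denominator the value is the one given by \<open>x / 0 = 0\<close>.
\<close>

datatype letter = Pos nat | Zero | Bar nat

definition letters :: "nat \<Rightarrow> letter set" where
  "letters s = Pos ` {1..s} \<union> {Zero} \<union> Bar ` {1..s}"

fun letter_less :: "letter \<Rightarrow> letter \<Rightarrow> bool"  (infix "\<prec>" 50) where
  "Pos a \<prec> Pos b \<longleftrightarrow> a < b"
| "Pos a \<prec> Zero \<longleftrightarrow> True"
| "Pos a \<prec> Bar b \<longleftrightarrow> True"
| "Zero \<prec> Pos b \<longleftrightarrow> False"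
| "Zero \<prec> Zero \<longleftrightarrow> False"
| "Zero \<prec> Bar b \<longleftrightarrow> True"
| "Bar a \<prec> Pos b \<longleftrightarrow> False"
| "Bar a \<prec> Zero \<longleftrightarrow> False"
| "Bar a \<prec> Bar b \<longleftrightarrow> b < a"

definition letter_le :: "letter \<Rightarrow> letter \<Rightarrow> bool"  (infix "\<preceq>" 50) where
  "c \<preceq> d \<longleftrightarrow> c = d \<or> c \<prec> d"

fun parity :: "letter \<Rightarrow> nat" where
  "parity Zero = 0"
| "parity (Pos a) = 1"
| "parity (Bar a) = 1"

definition psi :: "nat \<Rightarrow> (complex \<Rightarrow> complex) \<Rightarrow> letter \<Rightarrow> complex \<Rightarrow> complex" where
  "psi s \<phi> c u =
     (if c = Pos 1 then \<phi> (u - 2) * \<phi> (u - 2 * of_nat s - 1)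
      else if c = Bar 1 then \<phi> u * \<phi> (u - 2 * of_nat s + 1)
      else \<phi> u * \<phi> (u - 2 * of_nat s - 1))"

fun box :: "nat \<Rightarrow> (complex \<Rightarrow> complex) \<Rightarrow> (nat \<Rightarrow> complex \<Rightarrow> complex) \<Rightarrow> letter \<Rightarrow> complex \<Rightarrow> complex"
where
  "box s \<phi> Q (Pos a) u =
     psi s \<phi> (Pos a) u *
       (Q (a - 1) (u - of_nat a - 1) * Q a (u - of_nat a + 2)) /
       (Q (a - 1) (u - of_nat a + 1) * Q a (u - of_nat a))"
| "box s \<phi> Q Zero u =
     psi s \<phi> Zero u *
       (Q s (u - of_nat s + 1) * Q s (u - of_nat s - 2)) /
       (Q s (u - of_nat s - 1) * Q s (u - of_nat s))"
| "box s \<phi> Q (Bar a) u =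
     psi s \<phi> (Bar a) u *
       (Q (a - 1) (u - 2 * of_nat s + of_nat a) * Q a (u - 2 * of_nat s + of_nat a - 3)) /
       (Q (a - 1) (u - 2 * of_nat s + of_nat a - 2) * Q a (u - 2 * of_nat s + of_nat a - 1))"

text \<open>
  Fillings of the \<open>m \<times> n\<close> rectangle (row index first), strictly increasing along rows and weakly
  increasing down columns. The extensional function space makes each filling a single function.
\<close>

definition fillings :: "nat \<Rightarrow> nat \<Rightarrow> nat \<Rightarrow> (nat \<times> nat \<Rightarrow> letter) set" where
  "fillings s m n =
     {b \<in> ({1..m} \<times> {1..n}) \<rightarrow>\<^sub>E letters s.
        (\<forall>i\<in>{1..m}. \<forall>j\<in>{1..<n}. b (i, j) \<prec> b (i, j + 1)) \<and>
        (\<forall>i\<in>{1..<m}. \<forall>j\<in>{1..n}. b (i, j) \<preceq> b (i + 1, j))}"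

text \<open>In the following functions the arguments \<open>m\<close>, \<open>n\<close> are the numbers of rows and columns.\<close>

definition rect_T ::
  "nat \<Rightarrow> (complex \<Rightarrow> complex) \<Rightarrow> (nat \<Rightarrow> complex \<Rightarrow> complex) \<Rightarrow> nat \<Rightarrow> nat \<Rightarrow> complex \<Rightarrow> complex"
where
  "rect_T s \<phi> Q m n u =
     (\<Sum>b\<in>fillings s m n. \<Prod>i=1..m. \<Prod>j=1..n.
        (- 1) ^ parity (b (i, j)) *
        box s \<phi> Q (b (i, j)) (u - of_nat n + of_nat m - 2 * of_nat i + 2 * of_nat j))"

definition norm_F :: "nat \<Rightarrow> (complex \<Rightarrow> complex) \<Rightarrow> nat \<Rightarrow> complex \<Rightarrow> complex" where
  "norm_F s \<phi> n u =
     (\<Prod>j\<in>{1..<n}. \<phi> (u - of_nat n + 2 * of_nat j + 1) *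
                    \<phi> (u - 2 * of_nat s - of_nat n + 2 * of_nat j - 2))"

definition rect_T_norm ::
  "nat \<Rightarrow> (complex \<Rightarrow> complex) \<Rightarrow> (nat \<Rightarrow> complex \<Rightarrow> complex) \<Rightarrow> nat \<Rightarrow> nat \<Rightarrow> complex \<Rightarrow> complex"
where
  "rect_T_norm s \<phi> Q m n u =
     rect_T s \<phi> Q m n u / (\<Prod>j=1..m. norm_F s \<phi> n (u + of_nat m - 2 * of_nat j + 1))"

text \<open>
  \<open>T_fun s \<phi> Q a k\<close> is the function \<open>T\<^sub>k\<^sup>(\<^sup>a\<^sup>)\<close>. For \<open>a = s\<close> only even \<open>k\<close> are meaningful, and \<open>a > s\<close>
  does not occur.
\<close>

definition T_fun ::
  "nat \<Rightarrow> (complex \<Rightarrow> complex) \<Rightarrow> (nat \<Rightarrow> complex \<Rightarrow> complex) \<Rightarrow> nat \<Rightarrow> nat \<Rightarrow> complex \<Rightarrow> complex"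
where
  "T_fun s \<phi> Q a k u =
     (if a = 0 \<or> k = 0 then 1
      else if a < s then rect_T_norm s \<phi> Q k a u
      else rect_T_norm s \<phi> Q (k div 2) s u)"

definition T_zero :: "nat \<Rightarrow> (complex \<Rightarrow> complex) \<Rightarrow> complex \<Rightarrow> complex" where
  "T_zero s \<phi> u = \<phi> (u + 1) * \<phi> (u - 2 * of_nat s - 2)"

text \<open>
  \<open>g_fun s \<phi> b k\<close> is the function \<open>g\<^sub>k\<^sup>(\<^sup>b\<^sup>)\<close>; for \<open>s = 1\<close> it is only used with \<open>b = 1\<close> and \<open>k\<close> even.
\<close>

definition g_fun :: "nat \<Rightarrow> (complex \<Rightarrow> complex) \<Rightarrow> nat \<Rightarrow> nat \<Rightarrow> complex \<Rightarrow> complex" where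
  "g_fun s \<phi> b k u =
     (if s = 1 then (\<Prod>j=1..k div 2. T_zero s \<phi> (u + 2 * of_nat j - of_nat (k div 2) - 1))
      else (\<Prod>j=1..k. T_zero s \<phi> (u + 2 * of_nat j - of_nat k - 1)) ^ (if b = 1 then 1 else 0))"

end

(*
  Numbering the letters by 1, ..., L = 2s + 1, the sum over fillings of the m x n rectangle is a Schur-type
  function whose weights depend on the contents of the cells. Removing the cells with the largest
  letter proves a Jacobi-Trudi formula with entries e_(n-i+j), where e_n is the one-row sum, and the
  Desnanot-Jacobi identity for the (m+1) x (m+1) determinant becomes
    T_n^m(u-1) T_n^m(u+1) = T_n^(m-1)(u) T_n^(m+1)(u) + T_(n-1)^m(u) T_(n+1)^m(u).
  After normalization this gives the first two relations. For the third one, replacing the set of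
  letters of a row by the reflection of its complement shows that the normalized e_n and e_(L-n)
  agree; transposing the determinant, the normalized T_(s+1)^m and T_s^m agree.
*)
theory Submission
  imports Defs "Jordan_Normal_Form.Char_Poly"
begin

section \<open>The Desnanot--Jacobi identity\<close>

text \<open>With weights that depend on contents a determinant is still available because the
  argument of an entry depends on its column only, while the argument at which the largest letter
  splits off depends on its row only; so that letter can be peeled off row by row. For
  \<open>n = s\<close> the bilinear relation produces \<open>s + 1\<close> columns, and the system
  closes because \<open>s + 1 = L - s\<close>. The reflection is compatible with the weights
  because, after a factor common to all letters is split off, every signed box has the form
  \<open>\<sigma> c * R c x / R (c - 1) (x - 2)\<close> with \<open>R\<close> invariant, up to a
  shift of the argument, under exchanging \<open>k\<close> and \<open>L - k\<close>. The two ends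
  \<open>R 0\<close> and \<open>R L\<close> of this chain do not cancel; they account for the
  difference between what the normalization leaves over for \<open>s\<close> and for
  \<open>s + 1\<close> columns.\<close>

abbreviation fdet :: "nat \<Rightarrow> (nat \<Rightarrow> nat \<Rightarrow> 'a) \<Rightarrow> 'a :: comm_ring_1" where
  "fdet n f \<equiv> Determinant.det (Matrix.mat n n (\<lambda>(i, j). f i j))"

lemma fdet_leibniz:
  "fdet n f = (\<Sum>p | p permutes {0..<n}. signof p * (\<Prod>i = 0..<n. f i (p i)))"
proof -
  have "fdet n f = (\<Sum>p | p permutes {0..<n}. signof p *
          (\<Prod>i = 0..<n. Matrix.mat n n (\<lambda>(i, j). f i j) $$ (i, p i)))"
    by (rule det_def') simp
  also have "\<dots> = (\<Sum>p | p permutes {0..<n}. signof p * (\<Prod>i = 0..<n. f i (p i)))"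
    by (intro sum.cong refl arg_cong2[where f = "(*)"] prod.cong)
       (auto simp: permutes_in_image dest: permutes_in_image[of _ "{0..<n}"])
  finally show ?thesis .
qed

lemma mat_delete_first_first:
  "mat_delete (Matrix.mat (Suc n) (Suc n) (\<lambda>(i, j). f i j)) 0 0 =
     Matrix.mat n n (\<lambda>(i, j). f (Suc i) (Suc j))"
  by (rule eq_matI) (auto simp: mat_delete_def)

lemma mat_delete_last_last:
  "mat_delete (Matrix.mat (Suc n) (Suc n) (\<lambda>(i, j). f i j)) n n =
     Matrix.mat n n (\<lambda>(i, j). f i j)"
  by (rule eq_matI) (auto simp: mat_delete_def)

lemma mat_delete_first_last:
  "mat_delete (Matrix.mat (Suc n) (Suc n) (\<lambda>(i, j). f i j)) 0 n =
     Matrix.mat n n (\<lambda>(i, j). f (Suc i) j)"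
  by (rule eq_matI) (auto simp: mat_delete_def)

lemma mat_delete_last_first:
  "mat_delete (Matrix.mat (Suc n) (Suc n) (\<lambda>(i, j). f i j)) n 0 =
     Matrix.mat n n (\<lambda>(i, j). f i (Suc j))"
  by (rule eq_matI) (auto simp: mat_delete_def)

lemma fdet_first_column_unit:
  fixes d :: "'a :: comm_ring_1"
  shows "fdet (Suc n) (\<lambda>i j. if j = 0 then (if i = 0 then d else 0) else f i j) =
    d * fdet n (\<lambda>i j. f (Suc i) (Suc j))"
    (is "fdet _ ?g = _")
proof -
  let ?B = "Matrix.mat (Suc n) (Suc n) (\<lambda>(i, j). ?g i j)"
  have "fdet (Suc n) ?g = (\<Sum>i<Suc n. ?B $$ (i, 0) * cofactor ?B i 0)"
    by (rule laplace_expansion_column) auto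
  also have "\<dots> = (\<Sum>i<Suc n. if i = 0 then d * cofactor ?B 0 0 else 0)"
    by (rule sum.cong) auto
  also have "\<dots> = d * cofactor ?B 0 0"
    by simp
  finally show ?thesis
    by (simp add: cofactor_def mat_delete_first_first)
qed

lemma fdet_last_column_unit:
  fixes d :: "'a :: comm_ring_1"
  shows "fdet (Suc n) (\<lambda>i j. if j = n then (if i = n then d else 0) else f i j) = d * fdet n f"
    (is "fdet _ ?g = _")
proof -
  let ?B = "Matrix.mat (Suc n) (Suc n) (\<lambda>(i, j). ?g i j)"
  have "fdet (Suc n) ?g = (\<Sum>i<Suc n. ?B $$ (i, n) * cofactor ?B i n)"
    by (rule laplace_expansion_column) auto
  also have "\<dots> = (\<Sum>i<Suc n. if i = n then d * cofactor ?B n n else 0)"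
    by (rule sum.cong) auto
  also have "\<dots> = d * cofactor ?B n n"
    by simp
  also have "cofactor ?B n n = fdet n ?g"
    by (simp add: cofactor_def mat_delete_last_last flip: mult_2)
  also have "\<dots> = fdet n f"
    by (rule arg_cong[of _ _ Determinant.det]) (rule eq_matI, auto)
  finally show ?thesis .
qed

text \<open>In the Leibniz sum only the identity and the transposition of the two outer indices
  survive, because every inner column is a unit vector. Applied to columns of the adjugate, this
  yields a 2 x 2 minor of cofactors.\<close>

lemma fdet_identity_except_first_last:
  fixes a :: "nat \<Rightarrow> nat \<Rightarrow> 'a :: comm_ring_1"
  shows "fdet (Suc (Suc n)) (\<lambda>i j. if j = 0 \<or> j = Suc n then a i j else if i = j then 1 else 0) =
    a 0 0 * a (Suc n) (Suc n) - a 0 (Suc n) * a (Suc n) 0"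
    (is "fdet ?k ?g = _")
proof -
  let ?P = "{p. p permutes {0..<?k}}" and ?t = "Transposition.transpose 0 (Suc n)"
  let ?F = "\<lambda>p. signof p * (\<Prod>i = 0..<?k. ?g i (p i))"
  have prod_split: "(\<Prod>i = 0..<?k. h i) = h 0 * h (Suc n) * (\<Prod>i = 1..<Suc n. h i)"
    for h :: "nat \<Rightarrow> 'a"
  proof -
    have "{0..<?k} = insert 0 (insert (Suc n) {1..<Suc n})" by auto
    then show ?thesis by (simp add: mult.assoc)
  qed
  have t: "?t permutes {0..<?k}"
    by (rule permutes_swap_id) auto
  have zero: "?F p = 0" if p: "p \<in> ?P - {id, ?t}" for p
  proof (rule ccontr)
    assume "?F p \<noteq> 0"
    then have nz: "(\<Prod>i = 0..<?k. ?g i (p i)) \<noteq> 0" by (metis mult_zero_right)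
    have perm: "p permutes {0..<?k}" using p by simp
    have gi: "?g i (p i) \<noteq> 0" if "i < ?k" for i
    proof
      assume "?g i (p i) = 0"
      then have "(\<Prod>i = 0..<?k. ?g i (p i)) = 0"
        using that by (intro prod_zero bexI[of _ i]) simp_all
      with nz show False by simp
    qed
    \<comment> \<open>A permutation reaches column \<open>j\<close> from some row \<open>i\<close>;
      as column \<open>j\<close> is the \<open>j\<close>-th unit vector, a nonzero entry there
      forces \<open>i = j\<close>.\<close>
    have fixed: "p j = j" if "j \<noteq> 0" "j \<noteq> Suc n" for j
    proof (cases "j < ?k")
      case True
      obtain i where i: "p i = j" "i < ?k"
        using perm True permutes_image[of p "{0..<?k}"] by (metis atLeastLessThan_iff imageE zero_le)
      then show ?thesis using gi[of i] that by (auto split: if_splits)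
    next
      case False
      then show ?thesis using perm by (simp add: permutes_not_in)
    qed
    have sub: "p permutes {0, Suc n}"
      using perm fixed by (auto simp: permutes_def)
    have inj: "p 0 \<noteq> p (Suc n)" using permutes_inj[OF perm] by (metis injD nat.distinct(1))
    have im: "p 0 \<in> {0, Suc n}" "p (Suc n) \<in> {0, Suc n}"
      using permutes_in_image[OF sub] by auto
    have "p = id \<or> p = ?t"
    proof (cases "p 0 = 0")
      case True
      then have "p (Suc n) = Suc n" using im inj by auto
      then have "p j = j" for j using True fixed[of j] by (cases "j = 0"; cases "j = Suc n"; simp)
      then show ?thesis by auto
    next
      case False
      then have 1: "p 0 = Suc n" "p (Suc n) = 0" using im inj by auto
      have "p j = ?t j" for j using 1 fixed[of j]
        by (cases "j = 0"; cases "j = Suc n"; simp add: Transposition.transpose_def)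
      then show ?thesis by auto
    qed
    with p show False by simp
  qed
  have ne: "id \<noteq> ?t"
    by (metis id_apply nat.distinct(1) transpose_apply_first)
  have "fdet ?k ?g = (\<Sum>p \<in> ?P. ?F p)" by (rule fdet_leibniz)
  also have "\<dots> = (\<Sum>p \<in> {id, ?t}. ?F p)"
    using t zero by (intro sum.mono_neutral_right) (auto simp: finite_permutations permutes_id)
  also have "\<dots> = ?F id + ?F ?t" using ne by simp
  also have "(\<Prod>i = 0..<?k. ?g i (id i)) = a 0 0 * a (Suc n) (Suc n)"
    unfolding prod_split by simp
  also have "(\<Prod>i = 0..<?k. ?g i (?t i)) = a 0 (Suc n) * a (Suc n) 0"
  proof -
    have "(\<Prod>i = 1..<Suc n. ?g i (?t i)) = 1"
      by (rule prod.neutral) (auto simp: Transposition.transpose_def)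
    then show ?thesis unfolding prod_split by simp
  qed
  also have "signof ?t = (-1 :: 'a)"
    using sign_swap_id[of 0 "Suc n"] by simp
  finally show ?thesis by simp
qed

lemma adj_mat_index:
  "A \<in> carrier_mat n n \<Longrightarrow> i < n \<Longrightarrow> j < n \<Longrightarrow> adj_mat A $$ (i, j) = cofactor A j i"
  by (simp add: adj_mat_def)

text \<open>Jacobi's argument: \<open>?N\<close> is the identity with its first and last columns
  replaced by those of the adjugate of \<open>?A\<close>. In \<open>?A * ?N\<close> these two
  columns become \<open>?d\<close> times unit vectors and the others are those of \<open>?A\<close>,
  so the determinant is \<open>?d\<close> squared times the inner minor. One factor
  \<open>?d\<close> cancels against \<open>det ?A\<close>, and what remains is
  \<open>det ?N\<close>, a 2 x 2 minor of cofactors.\<close>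

lemma desnanot_jacobi_nonsingular:
  fixes f :: "nat \<Rightarrow> nat \<Rightarrow> 'a :: idom"
  assumes nz: "fdet (Suc (Suc n)) f \<noteq> 0"
  shows "fdet (Suc (Suc n)) f * fdet n (\<lambda>i j. f (Suc i) (Suc j)) =
    fdet (Suc n) f * fdet (Suc n) (\<lambda>i j. f (Suc i) (Suc j))
    - fdet (Suc n) (\<lambda>i j. f (Suc i) j) * fdet (Suc n) (\<lambda>i j. f i (Suc j))"
proof -
  let ?k = "Suc (Suc n)"
  let ?A = "Matrix.mat ?k ?k (\<lambda>(i, j). f i j)"
  let ?d = "Determinant.det ?A"
  let ?g = "\<lambda>i j. if j = 0 \<or> j = Suc n then adj_mat ?A $$ (i, j) else if i = j then 1 else 0"
  let ?N = "Matrix.mat ?k ?k (\<lambda>(i, j). ?g i j)"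
  let ?h = "\<lambda>i j. if j = 0 then (if i = 0 then ?d else 0)
               else (if j = Suc n then (if i = Suc n then ?d else 0) else f i j)"
  have A: "?A \<in> carrier_mat ?k ?k" by simp
  have AN: "?A * ?N = Matrix.mat ?k ?k (\<lambda>(i, j). ?h i j)"
  proof (rule eq_matI)
    fix i j assume "i < dim_row (Matrix.mat ?k ?k (\<lambda>(i, j). ?h i j))"
      and "j < dim_col (Matrix.mat ?k ?k (\<lambda>(i, j). ?h i j))"
    then have ij: "i < ?k" "j < ?k" by auto
    have prod: "(?A * ?N) $$ (i, j) = (\<Sum>l = 0..<?k. f i l * ?g l j)"
      using ij by (simp add: scalar_prod_def del: sum.op_ivl_Suc)
    show "(?A * ?N) $$ (i, j) = Matrix.mat ?k ?k (\<lambda>(i, j). ?h i j) $$ (i, j)"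
    proof (cases "j = 0 \<or> j = Suc n")
      case True
      have "(\<Sum>l = 0..<?k. f i l * ?g l j) = (\<Sum>l = 0..<?k. f i l * adj_mat ?A $$ (l, j))"
        using True by simp
      also have "\<dots> = (?A * adj_mat ?A) $$ (i, j)"
        using ij adj_mat(1)[OF A] by (simp add: scalar_prod_def del: sum.op_ivl_Suc)
      also have "\<dots> = (?d \<cdot>\<^sub>m 1\<^sub>m ?k) $$ (i, j)"
        by (simp only: adj_mat(2)[OF A])
      finally show ?thesis using prod ij True by auto
    next
      case False
      then have "(\<Sum>l = 0..<?k. f i l * ?g l j) = (\<Sum>l = 0..<?k. if l = j then f i j else 0)"
        by (intro sum.cong) auto
      then show ?thesis using prod ij False by (simp del: sum.op_ivl_Suc)
    qed
  qed auto
  have "Determinant.det (?A * ?N) = ?d * Determinant.det ?N"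
    by (rule det_mult) auto
  moreover have "Determinant.det (?A * ?N) = ?d * (?d * fdet n (\<lambda>i j. f (Suc i) (Suc j)))"
  proof -
    have "Determinant.det (?A * ?N) =
        ?d * fdet (Suc n) (\<lambda>i j. if j = n then (if i = n then ?d else 0) else f (Suc i) (Suc j))"
      unfolding AN fdet_first_column_unit by (simp only: nat.inject nat.distinct if_False)
    then show ?thesis by (simp only: fdet_last_column_unit)
  qed
  ultimately have N: "Determinant.det ?N = ?d * fdet n (\<lambda>i j. f (Suc i) (Suc j))"
    using nz by simp
  have sgn: "(-1 :: 'a) ^ Suc n * x * ((-1) ^ Suc n * y) = x * y" for x y
  proof -
    have "(-1 :: 'a) ^ Suc n * x * ((-1) ^ Suc n * y) = ((-1) ^ Suc n * (-1) ^ Suc n) * (x * y)"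
      by (simp only: ac_simps)
    then show ?thesis by (simp flip: power_add)
  qed
  have "Determinant.det ?N = adj_mat ?A $$ (0, 0) * adj_mat ?A $$ (Suc n, Suc n)
      - adj_mat ?A $$ (0, Suc n) * adj_mat ?A $$ (Suc n, 0)"
    by (rule fdet_identity_except_first_last)
  also have "\<dots> = cofactor ?A 0 0 * cofactor ?A (Suc n) (Suc n)
      - cofactor ?A (Suc n) 0 * cofactor ?A 0 (Suc n)"
    by (simp add: adj_mat_index[OF A])
  also have "\<dots> = fdet (Suc n) (\<lambda>i j. f (Suc i) (Suc j)) * fdet (Suc n) f
     - fdet (Suc n) (\<lambda>i j. f i (Suc j)) * fdet (Suc n) (\<lambda>i j. f (Suc i) j)"
    unfolding cofactor_def mat_delete_first_first mat_delete_last_last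
      mat_delete_first_last mat_delete_last_first
    using sgn by (simp flip: mult_2)
  finally show ?thesis using N by (simp add: mult.commute)
qed

lemma poly_fdet: "poly (fdet n f) x = fdet n (\<lambda>i j. poly (f i j) x)"
  for f :: "nat \<Rightarrow> nat \<Rightarrow> 'a :: comm_ring_1 poly"
  unfolding fdet_leibniz by (simp add: poly_sum poly_prod of_int_poly)

text \<open>Adding a formal variable to the diagonal makes any matrix nonsingular; it is set to 0 at the end.\<close>

theorem desnanot_jacobi:
  fixes f :: "nat \<Rightarrow> nat \<Rightarrow> 'a :: idom"
  shows "fdet (Suc (Suc n)) f * fdet n (\<lambda>i j. f (Suc i) (Suc j)) =
    fdet (Suc n) f * fdet (Suc n) (\<lambda>i j. f (Suc i) (Suc j))
    - fdet (Suc n) (\<lambda>i j. f (Suc i) j) * fdet (Suc n) (\<lambda>i j. f i (Suc j))"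
proof -
  define F where "F i j = (if i = j then [:f i j, 1:] else [:f i j:])" for i j
  have F0: "poly (F i j) 0 = f i j" for i j by (simp add: F_def)
  \<comment> \<open>The sign is chosen so that the characteristic matrix of \<open>?A\<close> is
    \<open>f\<close> plus the variable on the diagonal. Its determinant is monic, hence
    nonzero.\<close>
  let ?A = "Matrix.mat (Suc (Suc n)) (Suc (Suc n)) (\<lambda>(i, j). - f i j)"
  have "char_poly_matrix ?A = Matrix.mat (Suc (Suc n)) (Suc (Suc n)) (\<lambda>(i, j). F i j)"
    by (rule eq_matI) (auto simp: char_poly_matrix_def F_def)
  then have "fdet (Suc (Suc n)) F = char_poly ?A"
    by (simp add: char_poly_def)
  moreover have "monic (char_poly ?A)"
    using degree_monic_char_poly[of ?A "Suc (Suc n)"] by simp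
  ultimately have "fdet (Suc (Suc n)) F \<noteq> 0" by auto
  from arg_cong[OF desnanot_jacobi_nonsingular[OF this], of "\<lambda>p. poly p 0"]
  show ?thesis by (simp add: poly_fdet F0)
qed

section \<open>A Jacobi--Trudi formula with content-dependent weights\<close>

text \<open>
  Rows and columns are counted from 0, and \<open>l i\<close> is the length of row \<open>i\<close>. As in the definition of
  \<open>rect_T\<close>, rows increase strictly and columns weakly. The argument of a weight depends on the cell
  only through its content.
\<close>

definition cells :: "nat \<Rightarrow> (nat \<Rightarrow> nat) \<Rightarrow> (nat \<times> nat) set" where
  "cells m l = (SIGMA i:{..<m}. {..<l i})"

definition tableaux :: "nat \<Rightarrow> (nat \<Rightarrow> nat) \<Rightarrow> nat \<Rightarrow> (nat \<times> nat \<Rightarrow> nat) set" where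
  "tableaux m l k =
     {b \<in> cells m l \<rightarrow>\<^sub>E {1..k}.
        (\<forall>i j. i < m \<longrightarrow> Suc j < l i \<longrightarrow> b (i, j) < b (i, Suc j)) \<and>
        (\<forall>i j. Suc i < m \<longrightarrow> j < l (Suc i) \<longrightarrow> b (i, j) \<le> b (Suc i, j))}"

definition tableau_sum ::
  "(nat \<Rightarrow> 'a :: comm_ring_1 \<Rightarrow> 'b :: comm_ring_1) \<Rightarrow> nat \<Rightarrow> (nat \<Rightarrow> nat) \<Rightarrow> nat \<Rightarrow> 'a \<Rightarrow> 'b" where
  "tableau_sum y m l k v =
     (\<Sum>b\<in>tableaux m l k. \<Prod>(i, j)\<in>cells m l. y (b (i, j)) (v + 2 * of_nat j - 2 * of_nat i))"

text \<open>
  \<open>esum y k n v\<close> is the sum of \<open>y c\<^sub>1 (v + 2) \<cdots> y c\<^sub>n (v + 2 n)\<close> over \<open>1 \<le> c\<^sub>1 < \<cdots> < c\<^sub>n \<le> k\<close>. The index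
  \<open>n\<close> is an integer so that the entries below the support of the Jacobi--Trudi matrix vanish.
\<close>

fun esum :: "(nat \<Rightarrow> 'a :: comm_ring_1 \<Rightarrow> 'b :: comm_ring_1) \<Rightarrow> nat \<Rightarrow> int \<Rightarrow> 'a \<Rightarrow> 'b" where
  "esum y 0 n v = (if n = 0 then 1 else 0)"
| "esum y (Suc k) n v = esum y k n v + y (Suc k) (v + 2 * of_int n) * esum y k (n - 1) v"

lemma esum_neg: "n < 0 \<Longrightarrow> esum y k n v = 0"
  by (induction k arbitrary: n) auto

text \<open>Vertical strips, encoded by the rows they meet: a strip has at most one cell in each
  row, the last one. If the row below is equally long, its last cell lies under the removed one and
  has to go too. These are the possible positions of the largest letter, which strict rows confine
  to row ends and weak columns push downwards.\<close>

definition is_strip :: "nat \<Rightarrow> (nat \<Rightarrow> nat) \<Rightarrow> nat set \<Rightarrow> bool" where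
  "is_strip m l S \<longleftrightarrow>
     S \<subseteq> {..<m} \<and> (\<forall>i\<in>S. 0 < l i \<and> (Suc i < m \<and> l (Suc i) = l i \<longrightarrow> Suc i \<in> S))"

definition remove_strip :: "(nat \<Rightarrow> nat) \<Rightarrow> nat set \<Rightarrow> nat \<Rightarrow> nat" where
  "remove_strip l S i = (if i \<in> S then l i - 1 else l i)"

definition is_shape :: "nat \<Rightarrow> (nat \<Rightarrow> nat) \<Rightarrow> bool" where
  "is_shape m l \<longleftrightarrow> (\<forall>i. Suc i < m \<longrightarrow> l (Suc i) \<le> l i)"

section \<open>Removing the largest letter from a tableau\<close>

lemma finite_cells [simp, intro]: "finite (cells m l)"
  by (simp add: cells_def)

lemma finite_tableaux [simp, intro]: "finite (tableaux m l k)"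
  unfolding tableaux_def by (intro finite_subset[OF _ finite_PiE[of "cells m l" "\<lambda>_. {1..k}"]]) auto

lemma is_shape_remove_strip:
  "is_shape m l \<Longrightarrow> is_strip m l S \<Longrightarrow> is_shape m (remove_strip l S)"
  unfolding is_shape_def
proof (intro allI impI)
  fix i assume l: "\<forall>i. Suc i < m \<longrightarrow> l (Suc i) \<le> l i" and S: "is_strip m l S" and i: "Suc i < m"
  have "i \<in> S \<Longrightarrow> 0 < l i \<and> (l (Suc i) = l i \<longrightarrow> Suc i \<in> S)"
    using S i by (auto simp: is_strip_def)
  moreover have "l (Suc i) \<le> l i" using l i by blast
  ultimately show "remove_strip l S (Suc i) \<le> remove_strip l S i"
    by (cases "i \<in> S"; cases "Suc i \<in> S") (auto simp: remove_strip_def)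
qed

lemma tableaux_row_less:
  assumes "b \<in> tableaux m l k" "i < m" "j < j'" "j' < l i"
  shows "b (i, j) < b (i, j')"
  using assms(3,4)
proof (induction j')
  case (Suc j')
  have "b (i, j') < b (i, Suc j')"
    using assms(1,2) Suc.prems by (auto simp: tableaux_def)
  with Suc show ?case by (cases "j = j'") auto
qed simp

definition last_letter_rows :: "nat \<Rightarrow> (nat \<Rightarrow> nat) \<Rightarrow> nat \<Rightarrow> (nat \<times> nat \<Rightarrow> nat) \<Rightarrow> nat set" where
  "last_letter_rows m l k b = {i. i < m \<and> 0 < l i \<and> b (i, l i - 1) = k}"

lemma tableaux_range:
  assumes "b \<in> tableaux m l k" "i < m" "j < l i"
  shows "1 \<le> b (i, j)" "b (i, j) \<le> k"
  using assms by (auto simp: tableaux_def cells_def PiE_iff)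

lemma is_strip_last_letter_rows:
  assumes b: "b \<in> tableaux m l (Suc k)"
  shows "is_strip m l (last_letter_rows m l (Suc k) b)"
  unfolding is_strip_def
proof (intro conjI ballI impI)
  fix i assume i: "i \<in> last_letter_rows m l (Suc k) b"
  then show "0 < l i" by (simp add: last_letter_rows_def)
  assume s: "Suc i < m \<and> l (Suc i) = l i"
  have "b (i, l i - 1) \<le> b (Suc i, l i - 1)"
    using b s \<open>0 < l i\<close> by (auto simp: tableaux_def)
  moreover have "b (Suc i, l i - 1) \<le> Suc k"
    using tableaux_range(2)[OF b, of "Suc i" "l i - 1"] s \<open>0 < l i\<close> by simp
  ultimately show "Suc i \<in> last_letter_rows m l (Suc k) b"
    using i s by (auto simp: last_letter_rows_def)
qed (auto simp: last_letter_rows_def)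

lemma cells_remove_strip:
  assumes "is_strip m l S"
  shows "cells m l = cells m (remove_strip l S) \<union> (\<lambda>i. (i, l i - 1)) ` S"
    and "cells m (remove_strip l S) \<inter> (\<lambda>i. (i, l i - 1)) ` S = {}"
proof -
  have "(i, j) \<in> cells m l \<longleftrightarrow> (i, j) \<in> cells m (remove_strip l S) \<or> i \<in> S \<and> j = l i - 1" for i j
    using assms by (cases "i \<in> S") (auto simp: cells_def remove_strip_def is_strip_def)
  then show "cells m l = cells m (remove_strip l S) \<union> (\<lambda>i. (i, l i - 1)) ` S"
    by auto
  show "cells m (remove_strip l S) \<inter> (\<lambda>i. (i, l i - 1)) ` S = {}"
    by (auto simp: cells_def remove_strip_def)
qed

lemma tableaux_restrict:
  assumes l: "is_shape m l"
    and b: "b \<in> tableaux m l (Suc k)" and S: "last_letter_rows m l (Suc k) b = S"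
  shows "restrict b (cells m (remove_strip l S)) \<in> tableaux m (remove_strip l S) k"
proof -
  let ?l = "remove_strip l S"
  have sub: "j < l i" if "j < ?l i" for i j
    using that by (auto simp: remove_strip_def split: if_splits)
  have bound: "1 \<le> b (i, j) \<and> b (i, j) \<le> k" if "i < m" "j < ?l i" for i j
  proof -
    have j: "j < l i" using sub that by blast
    note r = tableaux_range[OF b \<open>i < m\<close>]
    show ?thesis
    proof (cases "j = l i - 1")
      case True
      then have "b (i, j) \<noteq> Suc k"
        using that j S by (auto simp: remove_strip_def last_letter_rows_def split: if_splits)
      then show ?thesis using r[OF j] by auto
    next
      case False
      then have "b (i, j) < b (i, l i - 1)" using j that by (intro tableaux_row_less[OF b]) auto
      moreover have "b (i, l i - 1) \<le> Suc k" using r(2)[of "l i - 1"] j by simp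
      ultimately show ?thesis using r[OF j] by auto
    qed
  qed
  have row: "b (i, j) < b (i, Suc j)" if "i < m" "Suc j < ?l i" for i j
    using b that sub by (auto simp: tableaux_def)
  have col: "b (i, j) \<le> b (Suc i, j)" if "Suc i < m" "j < ?l (Suc i)" for i j
    using b that sub by (auto simp: tableaux_def)
  have strip: "is_strip m l S" using is_strip_last_letter_rows[OF b] S by simp
  show ?thesis
    unfolding tableaux_def using bound row col is_shape_remove_strip[OF l strip]
    by (auto simp: cells_def is_shape_def)
qed

definition fill_strip ::
  "nat \<Rightarrow> (nat \<Rightarrow> nat) \<Rightarrow> nat set \<Rightarrow> nat \<Rightarrow> (nat \<times> nat \<Rightarrow> nat) \<Rightarrow> nat \<times> nat \<Rightarrow> nat" where
  "fill_strip m l S k b =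
     restrict (\<lambda>p. if p \<in> cells m (remove_strip l S) then b p else k) (cells m l)"

lemma tableaux_fill_strip:
  assumes l: "is_shape m l" and S: "is_strip m l S" and b: "b \<in> tableaux m (remove_strip l S) k"
  shows "fill_strip m l S (Suc k) b \<in> tableaux m l (Suc k)"
    and "last_letter_rows m l (Suc k) (fill_strip m l S (Suc k) b) = S"
proof -
  let ?l = "remove_strip l S" and ?c = "fill_strip m l S (Suc k) b"
  have sub: "j < l i" if "j < ?l i" for i j
    using that by (auto simp: remove_strip_def split: if_splits)
  have in': "?c (i, j) = b (i, j)" if "i < m" "j < ?l i" for i j
    using that sub by (auto simp: fill_strip_def cells_def)
  have out: "?c (i, j) = Suc k" if "i < m" "j < l i" "\<not> j < ?l i" for i j
    using that by (auto simp: fill_strip_def cells_def)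
  note r = tableaux_range[OF b]
  have bound: "1 \<le> ?c (i, j) \<and> ?c (i, j) \<le> Suc k" if "i < m" "j < l i" for i j
    using in'[of i j] out[of i j] r[of i j] that by (cases "j < ?l i") auto
  have row: "?c (i, j) < ?c (i, Suc j)" if "i < m" "Suc j < l i" for i j
  proof (cases "Suc j < ?l i")
    case True
    then show ?thesis using b that by (simp add: in' tableaux_def)
  next
    case False
    then have "j < ?l i" using that by (auto simp: remove_strip_def split: if_splits)
    with False show ?thesis using that r(2)[of i j] by (simp add: in' out less_Suc_eq_le)
  qed
  have shape: "is_shape m ?l" by (rule is_shape_remove_strip[OF l S])
  have col: "?c (i, j) \<le> ?c (Suc i, j)" if "Suc i < m" "j < l (Suc i)" for i j
  proof (cases "j < ?l (Suc i)")
    case True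
    then have "j < ?l i" using shape that by (auto simp: is_shape_def dest!: spec[of _ i])
    with True show ?thesis using b that by (simp add: in' tableaux_def)
  next
    case False
    moreover have "j < l i" using l that by (auto simp: is_shape_def dest!: spec[of _ i])
    ultimately show ?thesis using bound[of i j] that by (simp add: out)
  qed
  show "?c \<in> tableaux m l (Suc k)"
    unfolding tableaux_def using bound row col
    by (auto simp: cells_def PiE_iff fill_strip_def extensional_def)
  have "?c (i, l i - 1) = Suc k \<longleftrightarrow> i \<in> S" if "i < m" "0 < l i" for i
  proof (cases "i \<in> S")
    case True
    then show ?thesis using that out[of i "l i - 1"] by (simp add: remove_strip_def)
  next
    case False
    then show ?thesis using that in'[of i "l i - 1"] r(2)[of i "l i - 1"]
      by (auto simp: remove_strip_def)
  qed
  with S show "last_letter_rows m l (Suc k) ?c = S"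
    by (auto simp: last_letter_rows_def is_strip_def)
qed

text \<open>Branching rule: tableaux are grouped by the set of rows that end in
  \<open>Suc k\<close>. Deleting those cells and filling them in again are inverse to each other,
  and the deleted cells have known weights.\<close>

lemma tableau_sum_Suc:
  assumes l: "is_shape m l"
  shows "tableau_sum y m l (Suc k) v =
    (\<Sum>S | is_strip m l S. (\<Prod>i\<in>S. y (Suc k) (v + 2 * of_nat (l i - 1) - 2 * of_nat i)) *
       tableau_sum y m (remove_strip l S) k v)"
proof -
  let ?S = "last_letter_rows m l (Suc k)"
  let ?T = "tableaux m l (Suc k)"
  let ?w = "\<lambda>b (i, j). y (b (i, j)) (v + 2 * of_nat j - 2 * of_nat i)"
  have fin: "finite {S. is_strip m l S}"
    by (rule finite_subset[of _ "Pow {..<m}"]) (auto simp: is_strip_def)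
  have "tableau_sum y m l (Suc k) v =
      (\<Sum>S | is_strip m l S. \<Sum>b | b \<in> ?T \<and> ?S b = S. prod (?w b) (cells m l))"
    unfolding tableau_sum_def
    using is_strip_last_letter_rows by (subst sum.group[symmetric, OF _ fin, of _ ?S]) auto
  also have "\<dots> = (\<Sum>S | is_strip m l S.
      (\<Prod>i\<in>S. y (Suc k) (v + 2 * of_nat (l i - 1) - 2 * of_nat i)) *
       tableau_sum y m (remove_strip l S) k v)"
  proof (intro sum.cong refl)
    fix S assume "S \<in> {S. is_strip m l S}"
    then have S: "is_strip m l S" by simp
    let ?C = "cells m (remove_strip l S)"
    let ?R = "(\<lambda>i. (i, l i - 1)) ` S"
    have finS: "finite S" using S by (auto simp: is_strip_def intro: finite_subset)
    have sub: "?C \<subseteq> cells m l" using cells_remove_strip(1)[OF S] by blast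
    have "(\<Sum>b | b \<in> ?T \<and> ?S b = S. prod (?w b) (cells m l)) =
      (\<Sum>b\<in>tableaux m (remove_strip l S) k.
         (\<Prod>i\<in>S. y (Suc k) (v + 2 * of_nat (l i - 1) - 2 * of_nat i)) * prod (?w b) ?C)"
    proof (rule sum.reindex_bij_witness[where i = "fill_strip m l S (Suc k)"
          and j = "\<lambda>b. restrict b ?C"])
      fix b assume b: "b \<in> {b. b \<in> ?T \<and> ?S b = S}"
      then have ext: "b \<in> extensional (cells m l)"
        by (auto simp: tableaux_def PiE_def)
      have last: "b (i, l i - 1) = Suc k" if "i \<in> S" for i
        using b that by (auto simp: last_letter_rows_def)
      show "fill_strip m l S (Suc k) (restrict b ?C) = b"
      proof
        fix p
        show "fill_strip m l S (Suc k) (restrict b ?C) p = b p"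
          using last ext cells_remove_strip(1)[OF S]
          by (cases p) (auto simp: fill_strip_def extensional_def)
      qed
      show "restrict b ?C \<in> tableaux m (remove_strip l S) k"
        using b tableaux_restrict[OF l] by blast
      have "prod (?w b) (cells m l) = prod (?w b) ?C * prod (?w b) ?R"
        unfolding cells_remove_strip(1)[OF S] using cells_remove_strip(2)[OF S] finS
        by (intro prod.union_disjoint) auto
      also have "prod (?w b) ?R = (\<Prod>i\<in>S. ?w b (i, l i - 1))"
        by (subst prod.reindex) (auto simp: inj_on_def)
      also have "\<dots> = (\<Prod>i\<in>S. y (Suc k) (v + 2 * of_nat (l i - 1) - 2 * of_nat i))"
        by (intro prod.cong) (use last in auto)
      also have "prod (?w b) ?C = prod (?w (restrict b ?C)) ?C"
        by (intro prod.cong) auto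
      finally show "(\<Prod>i\<in>S. y (Suc k) (v + 2 * of_nat (l i - 1) - 2 * of_nat i)) *
          prod (?w (restrict b ?C)) ?C = prod (?w b) (cells m l)"
        by (simp add: mult.commute)
    next
      fix b assume b: "b \<in> tableaux m (remove_strip l S) k"
      then have ext: "b \<in> extensional ?C"
        by (auto simp: tableaux_def PiE_def)
      show "restrict (fill_strip m l S (Suc k) b) ?C = b"
        using sub ext by (auto simp: fill_strip_def restrict_def extensional_def fun_eq_iff)
      show "fill_strip m l S (Suc k) b \<in> {b. b \<in> ?T \<and> ?S b = S}"
        using tableaux_fill_strip[OF l S b] by simp
    qed
    then show "(\<Sum>b | b \<in> ?T \<and> ?S b = S. prod (?w b) (cells m l)) =
      (\<Prod>i\<in>S. y (Suc k) (v + 2 * of_nat (l i - 1) - 2 * of_nat i)) *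
         tableau_sum y m (remove_strip l S) k v"
      unfolding tableau_sum_def by (simp add: sum_distrib_left)
  qed
  finally show ?thesis .
qed

lemma tableau_sum_0:
  "tableau_sum y m l 0 v = (if \<forall>i<m. l i = 0 then 1 else 0)"
proof (cases "\<forall>i<m. l i = 0")
  case True
  then have "cells m l = {}" by (auto simp: cells_def)
  \<comment> \<open>Without cells there is one filling, the extensional function that is undefined
    everywhere.\<close>
  moreover have "tableaux m l 0 = {\<lambda>_. undefined}"
    using True calculation by (auto simp: tableaux_def)
  ultimately show ?thesis using True by (simp add: tableau_sum_def)
next
  case False
  then have "cells m l \<noteq> {}" by (auto simp: cells_def)
  then have "tableaux m l 0 = {}" by (auto simp: tableaux_def PiE_eq_empty_iff)
  with False show ?thesis by (simp add: tableau_sum_def)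
qed

section \<open>Multilinear expansion of determinants and the Jacobi-Trudi formula\<close>

lemma fdet_cong:
  "(\<And>i j. i < n \<Longrightarrow> j < n \<Longrightarrow> f i j = g i j) \<Longrightarrow> fdet n f = fdet n g"
  by (rule arg_cong[of _ _ Determinant.det]) (rule eq_matI, auto)

text \<open>Multilinearity in all rows at once: \<open>S\<close> records the rows that contribute
  their second summand.\<close>

lemma fdet_add_rows:
  "fdet n (\<lambda>i j. f i j + c i * g i j) =
     (\<Sum>S\<in>Pow {..<n}. (\<Prod>i\<in>S. c i) * fdet n (\<lambda>i j. if i \<in> S then g i j else f i j))"
proof -
  let ?P = "{p. p permutes {0..<n}}"
  have "fdet n (\<lambda>i j. f i j + c i * g i j) =
      (\<Sum>p\<in>?P. signof p * (\<Prod>i\<in>{..<n}. c i * g i (p i) + f i (p i)))"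
    unfolding fdet_leibniz by (simp add: add.commute atLeast0LessThan)
  also have "\<dots> = (\<Sum>p\<in>?P. \<Sum>S\<in>Pow {..<n}. signof p *
      ((\<Prod>i\<in>S. c i) * (\<Prod>i\<in>{..<n}. if i \<in> S then g i (p i) else f i (p i))))"
  proof (intro sum.cong refl)
    fix p
    have "(\<Prod>i\<in>{..<n}. c i * g i (p i) + f i (p i)) =
        (\<Sum>S\<in>Pow {..<n}. (\<Prod>i\<in>S. c i * g i (p i)) * (\<Prod>i\<in>{..<n} - S. f i (p i)))"
      by (rule prod_add) simp
    also have "\<dots> = (\<Sum>S\<in>Pow {..<n}.
        (\<Prod>i\<in>S. c i) * (\<Prod>i\<in>{..<n}. if i \<in> S then g i (p i) else f i (p i)))"
    proof (intro sum.cong refl)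
      fix S assume "S \<in> Pow {..<n}"
      then have "{..<n} = S \<union> ({..<n} - S)" "finite S" by (auto intro: finite_subset)
      then have "(\<Prod>i\<in>{..<n}. if i \<in> S then g i (p i) else f i (p i)) =
          (\<Prod>i\<in>S. g i (p i)) * (\<Prod>i\<in>{..<n} - S. f i (p i))"
        by (subst (1) \<open>{..<n} = S \<union> ({..<n} - S)\<close>, subst prod.union_disjoint)
           (auto intro!: arg_cong2[where f = "(*)"] prod.cong)
      then show "(\<Prod>i\<in>S. c i * g i (p i)) * (\<Prod>i\<in>{..<n} - S. f i (p i)) =
         (\<Prod>i\<in>S. c i) * (\<Prod>i\<in>{..<n}. if i \<in> S then g i (p i) else f i (p i))"
        by (simp add: prod.distrib mult.assoc)
    qed
    finally show "signof p * (\<Prod>i\<in>{..<n}. c i * g i (p i) + f i (p i)) =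
        (\<Sum>S\<in>Pow {..<n}. signof p *
      ((\<Prod>i\<in>S. c i) * (\<Prod>i\<in>{..<n}. if i \<in> S then g i (p i) else f i (p i))))"
      by (simp add: sum_distrib_left)
  qed
  also have "\<dots> = (\<Sum>S\<in>Pow {..<n}. (\<Prod>i\<in>S. c i) *
      fdet n (\<lambda>i j. if i \<in> S then g i j else f i j))"
    unfolding fdet_leibniz sum_distrib_left
    by (subst sum.swap) (simp add: atLeast0LessThan mult.left_commute)
  finally show ?thesis .
qed

lemma fdet_zero_row:
  assumes "r < n" "\<And>j. j < n \<Longrightarrow> f r j = 0"
  shows "fdet n f = 0"
  unfolding fdet_leibniz
proof (intro sum.neutral ballI)
  fix p assume "p \<in> {p. p permutes {0..<n}}"
  then have "p r < n" using permutes_in_image[of p "{0..<n}" r] assms(1) by simp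
  then have "(\<Prod>i = 0..<n. f i (p i)) = 0"
    using assms by (intro prod_zero bexI[of _ r]) auto
  then show "signof p * (\<Prod>i = 0..<n. f i (p i)) = 0" by simp
qed

lemma fdet_identical_rows:
  fixes f :: "nat \<Rightarrow> nat \<Rightarrow> 'a :: idom"
  assumes "r < n" "r' < n" "r \<noteq> r'" "\<And>j. j < n \<Longrightarrow> f r j = f r' j"
  shows "fdet n f = 0"
  by (rule det_identical_rows[of _ n r r']) (use assms in \<open>auto intro!: eq_vecI\<close>)

lemma fdet_identity: "fdet n (\<lambda>i j. if i = j then 1 else 0) = (1 :: 'a :: comm_ring_1)"
proof -
  have "Matrix.mat n n (\<lambda>(i, j). if i = j then 1 else 0) = (1\<^sub>m n :: 'a mat)"
    by (rule eq_matI) auto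
  then show ?thesis by (simp only: det_one)
qed

text \<open>
  The recursion of \<open>esum\<close> writes row \<open>i\<close> as a sum of two rows, those belonging to the row lengths
  \<open>l i\<close> and \<open>l i - 1\<close>. In the multilinear expansion the sets that are not strips contribute a
  determinant with two equal rows or a zero row; the others match \<open>tableau_sum_Suc\<close>.
\<close>

theorem jacobi_trudi:
  fixes y :: "nat \<Rightarrow> 'a :: comm_ring_1 \<Rightarrow> 'b :: idom"
  assumes "is_shape m l"
  shows "tableau_sum y m l k v =
    fdet m (\<lambda>i j. esum y k (int (l i) - int i + int j) (v - 2 * of_nat j - 2))"
  using assms
proof (induction k arbitrary: l)
  case 0
  show ?case
  proof (cases "\<forall>i<m. l i = 0")
    case True
    have "fdet m (\<lambda>i j. esum y 0 (int (l i) - int i + int j) (v - 2 * of_nat j - 2)) =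
        fdet m (\<lambda>i j. if i = j then 1 else 0)"
      by (rule fdet_cong) (use True in auto)
    with True show ?thesis by (simp add: tableau_sum_0 fdet_identity)
  next
    case False
    \<comment> \<open>Some row is nonempty, hence row 0 is. Its entries have the positive indices
      \<open>l 0 + j\<close>, and without letters \<open>esum\<close> vanishes there.\<close>
    have anti: "i < m \<Longrightarrow> l i \<le> l 0" for i
    proof (induction i)
      case (Suc i)
      then show ?case using 0 by (fastforce simp: is_shape_def intro: order_trans)
    qed simp
    from False have "0 < m" "0 < l 0" using anti by (force, metis le_zero_eq gr0I)
    then have "fdet m (\<lambda>i j. esum y 0 (int (l i) - int i + int j) (v - 2 * of_nat j - 2)) = 0"
      by (intro fdet_zero_row[of 0]) auto
    with False show ?thesis by (auto simp: tableau_sum_0)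
  qed
next
  case (Suc k)
  note l = \<open>is_shape m l\<close>
  let ?e = "\<lambda>r j. esum y k (r + int j) (v - 2 * of_nat j - 2)"
  \<comment> \<open>The recursion produces the argument
    \<open>(v - 2 j - 2) + 2 (l i - i + j)\<close>. Here \<open>j\<close> cancels, so the
    coefficient belongs to the whole row, and the result is the argument of the last cell of row
    \<open>i\<close>.\<close>
  let ?c = "\<lambda>i. y (Suc k) (v + 2 * of_int (int (l i) - 1 - int i))"
  let ?D = "\<lambda>S. fdet m (\<lambda>i j. if i \<in> S then ?e (int (l i) - int i - 1) j else ?e (int (l i) - int i) j)"
  have "fdet m (\<lambda>i j. esum y (Suc k) (int (l i) - int i + int j) (v - 2 * of_nat j - 2)) =
      fdet m (\<lambda>i j. ?e (int (l i) - int i) j + ?c i * ?e (int (l i) - int i - 1) j)"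
    by (rule fdet_cong) (simp add: algebra_simps)
  also have "\<dots> = (\<Sum>S\<in>Pow {..<m}. (\<Prod>i\<in>S. ?c i) * ?D S)"
    by (rule fdet_add_rows)
  also have "\<dots> = (\<Sum>S | is_strip m l S. (\<Prod>i\<in>S. ?c i) * ?D S)"
  proof (rule sum.mono_neutral_right)
    show "\<forall>S\<in>Pow {..<m} - {S. is_strip m l S}. (\<Prod>i\<in>S. ?c i) * ?D S = 0"
    proof
      fix S assume S: "S \<in> Pow {..<m} - {S. is_strip m l S}"
      have "?D S = 0"
      proof (cases "\<exists>i\<in>S. Suc i < m \<and> l (Suc i) = l i \<and> Suc i \<notin> S")
        case True
        \<comment> \<open>Row \<open>i\<close> is lowered by one through membership in
          \<open>S\<close>, row \<open>i + 1\<close> through its position: both have the index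
          \<open>l i - i - 1 + j\<close>.\<close>
        then obtain i where i: "i \<in> S" "Suc i < m" "l (Suc i) = l i" "Suc i \<notin> S" by blast
        then show ?thesis
          by (intro fdet_identical_rows[of i _ "Suc i"]) (auto simp: algebra_simps)
      next
        case False
        \<comment> \<open>The remaining way to fail is a row of length 0 in \<open>S\<close>. All
          rows below it are empty too and, as equally long neighbours, lie in \<open>S\<close>. The
          last row then has the indices \<open>j - m < 0\<close>.\<close>
        with S obtain i where i: "i \<in> S" "l i = 0" "i < m" by (auto simp: is_strip_def)
        have "i + d < m \<Longrightarrow> i + d \<in> S \<and> l (i + d) = 0" for d
        proof (induction d)
          case (Suc d)
          then have "l (Suc (i + d)) = 0"
            using l by (auto simp: is_shape_def dest!: spec[of _ "i + d"])
          with Suc False show ?case by auto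
        qed (use i in auto)
        from this[of "m - 1 - i"] have "m - 1 \<in> S" "l (m - 1) = 0" using i by auto
        then show ?thesis using i
          by (intro fdet_zero_row[of "m - 1"]) (auto intro!: esum_neg)
      qed
      then show "(\<Prod>i\<in>S. ?c i) * ?D S = 0" by simp
    qed
  qed (auto simp: is_strip_def)
  also have "\<dots> = (\<Sum>S | is_strip m l S.
      (\<Prod>i\<in>S. y (Suc k) (v + 2 * of_nat (l i - 1) - 2 * of_nat i)) *
       tableau_sum y m (remove_strip l S) k v)"
  proof (intro sum.cong refl arg_cong2[where f = "(*)"] prod.cong)
    fix S assume "S \<in> {S. is_strip m l S}"
    then have S: "is_strip m l S" by simp
    then have pos: "0 < l i" if "i \<in> S" for i using that by (auto simp: is_strip_def)
    show "?c i = y (Suc k) (v + 2 * of_nat (l i - 1) - 2 * of_nat i)" if "i \<in> S" for i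
      using pos[OF that] by (simp add: algebra_simps Suc_le_eq)
    have "?D S = fdet m (\<lambda>i j. ?e (int (remove_strip l S i) - int i) j)"
      by (rule fdet_cong) (auto simp: remove_strip_def Suc_le_eq dest!: pos
          intro!: arg_cong[where f = "\<lambda>r. esum y k r _"])
    then show "?D S = tableau_sum y m (remove_strip l S) k v"
      using Suc.IH[OF is_shape_remove_strip[OF l S]] by simp
  qed
  finally show ?case using tableau_sum_Suc[OF l] by simp
qed

section \<open>Rectangular shapes and duality\<close>

text \<open>The shift \<open>- n + m\<close> is the one in \<open>rect_T\<close>; the remaining
  \<open>- 2 i + 2 j\<close> is unaffected by counting both rows and columns from 0.\<close>

definition rect_sum ::
  "(nat \<Rightarrow> 'a :: comm_ring_1 \<Rightarrow> 'b :: comm_ring_1) \<Rightarrow> nat \<Rightarrow> nat \<Rightarrow> nat \<Rightarrow> 'a \<Rightarrow> 'b" where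
  "rect_sum y k m n u = tableau_sum y m (\<lambda>_. n) k (u - of_nat n + of_nat m)"

lemma rect_sum_eq_fdet:
  fixes y :: "nat \<Rightarrow> 'a :: comm_ring_1 \<Rightarrow> 'b :: idom"
  shows "rect_sum y k m n u =
    fdet m (\<lambda>i j. esum y k (int n - int i + int j) (u - of_nat n + of_nat m - 2 * of_nat j - 2))"
  unfolding rect_sum_def by (rule jacobi_trudi) (simp add: is_shape_def)

lemma rect_sum_no_cells:
  "m = 0 \<or> n = 0 \<Longrightarrow> rect_sum y k m n u = 1"
proof -
  assume "m = 0 \<or> n = 0"
  then have "cells m (\<lambda>_. n) = {}" by (auto simp: cells_def)
  moreover have "tableaux m (\<lambda>_. n) k = {\<lambda>_. undefined}"
    using \<open>m = 0 \<or> n = 0\<close> calculation by (auto simp: tableaux_def)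
  ultimately show ?thesis by (simp add: rect_sum_def tableau_sum_def)
qed

text \<open>The matrix is that of \<open>m + 1\<close> rows. The index of an entry is
  \<open>n - i + j\<close>, so dropping the first row lowers \<open>n\<close> and dropping the first
  column raises it. Dropping both, or neither, keeps \<open>n\<close>; the size of the minor and the
  shifted arguments then give the values at \<open>u - 1\<close>, \<open>u\<close> and
  \<open>u + 1\<close>.\<close>

lemma rect_sum_t_system:
  fixes y :: "nat \<Rightarrow> 'a :: comm_ring_1 \<Rightarrow> 'b :: idom"
  assumes "m \<ge> 1" "n \<ge> 1"
  shows "rect_sum y k m n (u - 1) * rect_sum y k m n (u + 1) =
    rect_sum y k (m - 1) n u * rect_sum y k (m + 1) n u +
    rect_sum y k m (n - 1) u * rect_sum y k m (n + 1) u"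
proof -
  obtain m' n' where mn: "m = Suc m'" "n = Suc n'"
    using assms by (metis Suc_le_D One_nat_def)
  let ?f = "\<lambda>i j. esum y k (int n - int i + int j) (u - of_nat n + of_nat (Suc m) - 2 * of_nat j - 2)"
  have 1: "fdet (Suc (Suc m')) ?f = rect_sum y k (m + 1) n u"
    unfolding rect_sum_eq_fdet mn by simp
  have 2: "fdet m' (\<lambda>i j. ?f (Suc i) (Suc j)) = rect_sum y k (m - 1) n u"
    unfolding rect_sum_eq_fdet mn by (simp add: algebra_simps)
  have 3: "fdet (Suc m') ?f = rect_sum y k m n (u + 1)"
    unfolding rect_sum_eq_fdet mn by (simp add: algebra_simps)
  have 4: "fdet (Suc m') (\<lambda>i j. ?f (Suc i) (Suc j)) = rect_sum y k m n (u - 1)"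
    unfolding rect_sum_eq_fdet mn by (simp add: algebra_simps)
  have 5: "fdet (Suc m') (\<lambda>i j. ?f (Suc i) j) = rect_sum y k m (n - 1) u"
    unfolding rect_sum_eq_fdet mn by (simp add: algebra_simps)
  have 6: "fdet (Suc m') (\<lambda>i j. ?f i (Suc j)) = rect_sum y k m (n + 1) u"
    unfolding rect_sum_eq_fdet mn by (simp add: algebra_simps)
  show ?thesis
    using desnanot_jacobi[of m' ?f] unfolding 1 2 3 4 5 6 by (simp add: algebra_simps)
qed

section \<open>Duality of one-row sums under reflected complements\<close>

lemma esum_eq_0: "n > int k \<Longrightarrow> esum y k n v = 0"
  by (induction k arbitrary: n) auto

text \<open>A strictly increasing row is determined by its set of letters, and the cardinality in
  the argument is the position of \<open>c\<close> in that row. In this form complements can be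
  taken.\<close>

lemma esum_subsets:
  "esum y k (int n) v =
     (\<Sum>S | S \<subseteq> {1..k} \<and> card S = n. \<Prod>c\<in>S. y c (v + 2 * of_nat (card {d \<in> S. d \<le> c})))"
proof (induction k arbitrary: n)
  case 0
  have "{S. S \<subseteq> {1..0::nat} \<and> card S = n} = (if n = 0 then {{}} else {})"
    by auto
  then show ?case by simp
next
  case (Suc k)
  let ?w = "\<lambda>S. \<Prod>c\<in>S. y c (v + 2 * of_nat (card {d \<in> S. d \<le> c}))"
  let ?A = "\<lambda>(k :: nat) n. {S. S \<subseteq> {1..k} \<and> card S = n}"
  have fin: "finite (?A k n)" for k n
    by (rule finite_subset[of _ "Pow {1..k}"]) auto
  have fs: "finite S" if "S \<in> ?A k n" for S k n
    using that finite_subset[of S "{1..k}"] by simp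
  have with_last: "(\<Sum>S | S \<in> ?A (Suc k) n \<and> Suc k \<in> S. ?w S) =
      y (Suc k) (v + 2 * of_nat n) * esum y k (int n - 1) v"
  proof (cases n)
    case 0
    have "\<not> (S \<in> ?A (Suc k) n \<and> Suc k \<in> S)" for S
    proof
      assume S: "S \<in> ?A (Suc k) n \<and> Suc k \<in> S"
      then have "finite S" using fs by blast
      moreover have "card S = 0" using S 0 by blast
      ultimately show False using S by (metis card_0_eq empty_iff)
    qed
    then have "{S. S \<in> ?A (Suc k) n \<and> Suc k \<in> S} = {}" by blast
    then have "(\<Sum>S | S \<in> ?A (Suc k) n \<and> Suc k \<in> S. ?w S) = 0"
      by (simp only: sum.empty)
    with 0 show ?thesis by (simp add: esum_neg)
  next
    case (Suc n')
    have "(\<Sum>S | S \<in> ?A (Suc k) n \<and> Suc k \<in> S. ?w S) =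
      (\<Sum>S\<in>?A k n'. y (Suc k) (v + 2 * of_nat n) * ?w S)"
    proof (rule sum.reindex_bij_witness[where i = "insert (Suc k)" and j = "\<lambda>S. S - {Suc k}"])
      fix S assume S: "S \<in> {S. S \<in> ?A (Suc k) n \<and> Suc k \<in> S}"
      then have finS: "finite S" using fs[of S "Suc k" n] by simp
      show "insert (Suc k) (S - {Suc k}) = S" using S by auto
      show "S - {Suc k} \<in> ?A k n'"
        using S Suc finS by (auto simp: le_Suc_eq)
      \<comment> \<open>\<open>Suc k\<close> is the maximum of \<open>S\<close>, so its position is
        \<open>card S\<close> and its removal leaves the other positions unchanged.\<close>
      have "?w S = y (Suc k) (v + 2 * of_nat (card {d \<in> S. d \<le> Suc k})) *
          (\<Prod>c\<in>S - {Suc k}. y c (v + 2 * of_nat (card {d \<in> S. d \<le> c})))"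
        using S finS by (subst prod.remove[of _ "Suc k"]) auto
      also have "{d \<in> S. d \<le> Suc k} = S" using S by auto
      also have "(\<Prod>c\<in>S - {Suc k}. y c (v + 2 * of_nat (card {d \<in> S. d \<le> c}))) = ?w (S - {Suc k})"
      proof (rule prod.cong)
        fix c assume "c \<in> S - {Suc k}"
        then have "{d \<in> S. d \<le> c} = {d \<in> S - {Suc k}. d \<le> c}" using S by (auto simp: le_Suc_eq)
        then show "y c (v + 2 * of_nat (card {d \<in> S. d \<le> c})) =
          y c (v + 2 * of_nat (card {d \<in> S - {Suc k}. d \<le> c}))" by simp
      qed simp
      finally show "y (Suc k) (v + 2 * of_nat n) * ?w (S - {Suc k}) = ?w S"
        using S by simp
    next
      fix S assume S: "S \<in> ?A k n'"
      then have "Suc k \<notin> S" by auto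
      then show "insert (Suc k) S - {Suc k} = S"
        "insert (Suc k) S \<in> {S. S \<in> ?A (Suc k) n \<and> Suc k \<in> S}"
        using S Suc fs[OF S] by auto
    qed
    then show ?thesis using Suc Suc.IH[of n'] by (simp add: sum_distrib_left)
  qed
  have "?A k n = {S. S \<in> ?A (Suc k) n \<and> Suc k \<notin> S}"
    by (auto simp: le_Suc_eq atLeastAtMostSuc_conv)
  then have without_last: "(\<Sum>S | S \<in> ?A (Suc k) n \<and> Suc k \<notin> S. ?w S) = esum y k (int n) v"
    using Suc.IH[of n] by simp
  have "(\<Sum>S\<in>?A (Suc k) n. ?w S) =
      (\<Sum>S | S \<in> ?A (Suc k) n \<and> Suc k \<notin> S. ?w S) + (\<Sum>S | S \<in> ?A (Suc k) n \<and> Suc k \<in> S. ?w S)"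
    by (subst sum.union_disjoint[symmetric]) (auto simp: fin intro!: sum.cong)
  then show ?case using with_last without_last by simp
qed

lemma prod_telescope:
  fixes h :: "nat \<Rightarrow> 'a :: field"
  assumes "\<And>c. h c \<noteq> 0"
  shows "(\<Prod>c = 1..L. h c / h (c - 1)) = h L / h 0"
  by (induction L) (use assms in \<open>auto simp: prod.nat_ivl_Suc'\<close>)

definition dual_set :: "nat \<Rightarrow> nat set \<Rightarrow> nat set" where
  "dual_set L S = {c \<in> {1..L}. Suc L - c \<notin> S}"

lemma dual_set_eq_image: "dual_set L S = (\<lambda>c. Suc L - c) ` ({1..L} - S)"
proof (rule subset_antisym; rule subsetI)
  fix x assume "x \<in> dual_set L S"
  then show "x \<in> (\<lambda>c. Suc L - c) ` ({1..L} - S)"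
    by (intro image_eqI[of _ _ "Suc L - x"]) (auto simp: dual_set_def)
qed (auto simp: dual_set_def)

lemma dual_set_dual_set: "S \<subseteq> {1..L} \<Longrightarrow> dual_set L (dual_set L S) = S"
  by (auto simp: dual_set_def)

lemma inj_on_reflect: "A \<subseteq> {1..L} \<Longrightarrow> inj_on (\<lambda>c. Suc L - c) A"
  by (auto simp: inj_on_def subset_iff)

lemma card_dual_set:
  assumes "S \<subseteq> {1..L}"
  shows "card (dual_set L S) = L - card S"
proof -
  have "finite S" using assms by (auto intro: finite_subset)
  then show ?thesis
    unfolding dual_set_eq_image using assms
    by (subst card_image[OF inj_on_reflect]) (auto simp: card_Diff_subset)
qed

text \<open>The position of the reflected letter counts the elements of \<open>{c..L}\<close>
  outside \<open>S\<close>. These are \<open>L + 1 - c\<close> minus the members of \<open>S\<close>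
  above \<open>c\<close>. The additive form avoids truncated subtraction.\<close>

lemma card_dual_set_le:
  assumes S: "S \<subseteq> {1..L}" and c: "c \<in> {1..L} - S"
  shows "card {d \<in> dual_set L S. d \<le> Suc L - c} + c + card S =
    Suc L + card {d \<in> S. d \<le> c}"
proof -
  have fin: "finite S" using S by (auto intro: finite_subset)
  have "{d \<in> dual_set L S. d \<le> Suc L - c} = (\<lambda>c. Suc L - c) ` ({c..L} - S)"
    unfolding dual_set_eq_image using c by auto
  then have "card {d \<in> dual_set L S. d \<le> Suc L - c} = card ({c..L} - S)"
    using c by (simp add: card_image[OF inj_on_reflect] subset_iff)
  moreover have "card {c..L} = card ({c..L} - S) + card ({c..L} \<inter> S)"
    using card_mono[of "{c..L}" "{c..L} \<inter> S"] by (simp add: card_Diff_subset_Int)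
  moreover have "card S = card {d \<in> S. d \<le> c} + card ({c..L} \<inter> S)"
  proof -
    have "S = {d \<in> S. d \<le> c} \<union> ({c..L} \<inter> S)" using S by auto
    moreover have "{d \<in> S. d \<le> c} \<inter> ({c..L} \<inter> S) = {}" using c by (auto dest: le_antisym)
    ultimately show ?thesis using fin card_Un_disjoint[of "{d \<in> S. d \<le> c}" "{c..L} \<inter> S"] by simp
  qed
  ultimately show ?thesis using c by auto
qed

text \<open>
  The identity holds termwise: with \<open>h c = R c (v + 2 N(c))\<close>, where \<open>N(c)\<close> counts the elements of \<open>S\<close>
  up to \<open>c\<close>, a letter \<open>c \<in> S\<close> contributes \<open>\<sigma> c * h c / h (c - 1)\<close> to the term of \<open>S\<close>, and a letter
  \<open>c \<notin> S\<close> contributes the inverse of this expression to the term of \<open>dual_set L S\<close>. The quotient of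
  the two terms telescopes.
\<close>

lemma esum_duality:
  fixes R :: "nat \<Rightarrow> 'a :: comm_ring_1 \<Rightarrow> 'b :: field"
  assumes R: "\<And>k x. R k x \<noteq> 0"
    and R_dual: "\<And>k x. k \<le> L \<Longrightarrow> R (L - k) (x + of_nat L - 2 * of_nat k) = R k x"
    and \<sigma>_dual: "\<And>c. c \<in> {1..L} \<Longrightarrow> \<sigma> (Suc L - c) = \<sigma> c"
    and \<sigma>_sq: "\<And>c. \<sigma> c * \<sigma> c = 1"
    and \<sigma>_prod: "(\<Prod>c = 1..L. \<sigma> c) = 1"
    and y: "\<And>c x. y c x = \<sigma> c * R c x / R (c - 1) (x - 2)"
  shows "esum y L (int L - n) (v + 2 * of_int n - of_nat L) * R L (v + 2 * of_int n) =
    esum y L n v * R 0 v"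
proof (cases "0 \<le> n \<and> n \<le> int L")
  case False
  \<comment> \<open>\<open>n\<close> and \<open>L - n\<close> leave the range from 0 to
    \<open>L\<close> together, so both sides vanish.\<close>
  then show ?thesis by (auto simp: esum_neg esum_eq_0)
next
  case True
  then obtain k where k: "n = int k" "k \<le> L" by (metis zero_le_imp_eq_int of_nat_le_iff)
  define N where "N S c = card {d \<in> S. d \<le> c}" for S :: "nat set" and c
  let ?v = "v + 2 * of_nat k - of_nat L"
  have termwise: "(\<Prod>c\<in>dual_set L S. y c (?v + 2 * of_nat (N (dual_set L S) c))) * R L (v + 2 * of_nat k) =
      (\<Prod>c\<in>S. y c (v + 2 * of_nat (N S c))) * R 0 v"
    if S: "S \<subseteq> {1..L}" "card S = k" for S
  proof -
    have finS: "finite S" using S by (auto intro: finite_subset)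
    define h where "h c = R c (v + 2 * of_nat (N S c))" for c
    define t where "t c = \<sigma> c * (h c / h (c - 1))" for c
    have h: "h c \<noteq> 0" for c by (simp add: h_def R)
    have \<sigma>0: "\<sigma> c \<noteq> 0" for c using \<sigma>_sq[of c] by auto
    have \<sigma>_inv: "inverse (\<sigma> c) = \<sigma> c" for c using \<sigma>_sq[of c] by (rule inverse_unique)
    have t: "t c \<noteq> 0" for c by (simp add: t_def h \<sigma>0)
    \<comment> \<open>Passing a letter of \<open>S\<close> raises the count by one, which is exactly
      the shift by 2 in the denominator of \<open>y\<close>.\<close>
    have in_S: "y c (v + 2 * of_nat (N S c)) = t c" if "c \<in> S" for c
    proof -
      have "c \<ge> 1" using that S by auto
      then have "{d \<in> S. d \<le> c} = insert c {d \<in> S. d \<le> c - 1}" using that by auto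
      moreover have "c \<notin> {d \<in> S. d \<le> c - 1}" "finite {d \<in> S. d \<le> c - 1}"
        using \<open>c \<ge> 1\<close> finS by auto
      ultimately have "N S c = Suc (N S (c - 1))"
        unfolding N_def by (metis card_insert_disjoint)
      then show ?thesis unfolding y t_def h_def by simp
    qed
    have out_S: "y (Suc L - c) (?v + 2 * of_nat (N (dual_set L S) (Suc L - c))) = inverse (t c)"
      if c: "c \<in> {1..L} - S" for c
    proof -
      have "{d \<in> S. d \<le> c} = {d \<in> S. d \<le> c - 1}" using c by (auto simp: le_eq_less_or_eq)
      then have N: "N S (c - 1) = N S c" by (simp add: N_def)
      have "N (dual_set L S) (Suc L - c) + c + k = Suc L + N S c"
        unfolding N_def using card_dual_set_le[OF S(1) c] S(2) by simp
      then have "(of_nat (N (dual_set L S) (Suc L - c)) :: 'a) + of_nat c + of_nat k = 1 + of_nat L + of_nat (N S c)"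
        by (metis of_nat_add of_nat_Suc)
      then have N': "(of_nat (N (dual_set L S) (Suc L - c)) :: 'a) = 1 + of_nat L + of_nat (N S c) - of_nat c - of_nat k"
        by (simp add: algebra_simps)
      have Lc: "L - (c - 1) = Suc L - c" using c by auto
      have c1': "c - 1 \<le> L" using c by auto
      have c1: "(of_nat (c - 1) :: 'a) = of_nat c - 1" using c by (simp add: of_nat_diff)
      \<comment> \<open>The argument of the dual letter works out as
        \<open>x + L - 2 (c - 1)\<close> with \<open>x = v + 2 N(c)\<close>. So
        \<open>R_dual\<close> applies at \<open>c - 1\<close> here and, after subtracting 2, at
        \<open>c\<close> below; numerator and denominator change places.\<close>
      have "R (Suc L - c) (?v + 2 * of_nat (N (dual_set L S) (Suc L - c))) = h (c - 1)"
        using R_dual[OF c1', of "v + 2 * of_nat (N S c)"]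
        unfolding h_def N N' c1 Lc by (simp add: algebra_simps)
      moreover have "R (L - c) (?v + 2 * of_nat (N (dual_set L S) (Suc L - c)) - 2) = h c"
        using c R_dual[of c "v + 2 * of_nat (N S c)"]
        unfolding h_def N' by (simp add: algebra_simps)
      moreover have "Suc L - c - 1 = L - c" by simp
      ultimately show ?thesis
        unfolding y t_def using \<sigma>_dual[of c] c by (simp add: \<sigma>_inv inverse_mult_distrib divide_inverse mult_ac)
    qed
    have all: "(\<Prod>c = 1..L. t c) = h L / h 0"
      unfolding t_def prod.distrib \<sigma>_prod prod_telescope[of h, OF h] by simp
    have "(\<Prod>c\<in>dual_set L S. y c (?v + 2 * of_nat (N (dual_set L S) c))) =
        (\<Prod>c\<in>{1..L} - S. inverse (t c))"
      by (subst (1) dual_set_eq_image, subst prod.reindex[OF inj_on_reflect])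
         (auto simp: out_S intro!: prod.cong)
    moreover have "(\<Prod>c\<in>S. y c (v + 2 * of_nat (N S c))) = (\<Prod>c\<in>S. t c)"
      by (intro prod.cong refl in_S)
    moreover have "(\<Prod>c = 1..L. t c) = (\<Prod>c\<in>{1..L} - S. t c) * (\<Prod>c\<in>S. t c)"
      using S by (intro prod.subset_diff) auto
    moreover have "(\<Prod>c\<in>{1..L} - S. t c) \<noteq> 0" by (simp add: t)
    moreover have "N S L = k" "N S 0 = 0"
    proof -
      have "{d \<in> S. d \<le> L} = S" "{d \<in> S. d \<le> 0} = {}" using S by auto
      then show "N S L = k" "N S 0 = 0" using S(2) by (simp_all add: N_def)
    qed
    then have hL: "h L = R L (v + 2 * of_nat k)" "h 0 = R 0 v" by (simp_all add: h_def)
    moreover have "(\<Prod>c\<in>{1..L} - S. inverse (t c)) = inverse (\<Prod>c\<in>{1..L} - S. t c)"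
      using prod_inversef[of t] by (simp add: o_def)
    moreover have "inverse B * h L = A * h 0" if "C = B * A" "C = h L / h 0" "B \<noteq> 0" for A B C
      using that h[of 0] by (simp add: field_simps)
    ultimately show ?thesis
      using all by (metis hL)
  qed
  let ?A = "\<lambda>k. {S. S \<subseteq> {1..L} \<and> card S = k}"
  have "esum y L (int (L - k)) ?v * R L (v + 2 * of_nat k) =
      (\<Sum>S\<in>?A (L - k). (\<Prod>c\<in>S. y c (?v + 2 * of_nat (N S c))) * R L (v + 2 * of_nat k))"
    unfolding esum_subsets N_def by (simp add: sum_distrib_right)
  also have "\<dots> = (\<Sum>S\<in>?A k. (\<Prod>c\<in>S. y c (v + 2 * of_nat (N S c))) * R 0 v)"
  proof (rule sum.reindex_bij_witness[where i = "dual_set L" and j = "dual_set L"])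
    fix S assume "S \<in> ?A (L - k)"
    then have S: "S \<subseteq> {1..L}" "card S = L - k" by auto
    show "dual_set L (dual_set L S) = S" using dual_set_dual_set S by simp
    show D: "dual_set L S \<in> ?A k"
      using card_dual_set[OF S(1)] S k by (auto simp: dual_set_def)
    show "(\<Prod>c\<in>dual_set L S. y c (v + 2 * of_nat (N (dual_set L S) c))) * R 0 v =
      (\<Prod>c\<in>S. y c (?v + 2 * of_nat (N S c))) * R L (v + 2 * of_nat k)"
      using termwise[of "dual_set L S"] D dual_set_dual_set[OF S(1)] by simp
  next
    fix S assume "S \<in> ?A k"
    then have S: "S \<subseteq> {1..L}" "card S = k" by auto
    show "dual_set L (dual_set L S) = S" using dual_set_dual_set S by simp
    show "dual_set L S \<in> ?A (L - k)"
      using card_dual_set[OF S(1)] S k by (auto simp: dual_set_def)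
  qed
  also have "\<dots> = esum y L (int k) v * R 0 v"
    unfolding esum_subsets N_def by (simp add: sum_distrib_right)
  finally show ?thesis using k by (simp add: of_nat_diff)
qed

lemma fdet_scale_columns:
  "fdet n (\<lambda>i j. f i j * c j) = (\<Prod>j<n. c j) * fdet n f"
proof -
  have "(\<Prod>i = 0..<n. c (p i)) = (\<Prod>j<n. c j)" if "p permutes {0..<n}" for p
    using prod.permute[OF that, of c] by (simp add: o_def atLeast0LessThan)
  then show ?thesis
    unfolding fdet_leibniz sum_distrib_left
    by (intro sum.cong) (simp_all add: prod.distrib mult_ac)
qed

lemma fdet_transpose: "fdet n (\<lambda>i j. f j i) = fdet n f"
proof -
  have "transpose_mat (Matrix.mat n n (\<lambda>(i, j). f i j)) = Matrix.mat n n (\<lambda>(i, j). f j i)"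
    by (rule eq_matI) auto
  then show ?thesis using det_transpose[of "Matrix.mat n n (\<lambda>(i, j). f i j)" n] by simp
qed

text \<open>Complementing sends the index \<open>s + 1 - i + j\<close> to \<open>s - j + i\<close>,
  and its argument, which depended on the column \<open>j\<close>, to one that depends on the row
  \<open>i\<close>. So the dual entries form the transpose of the matrix for \<open>s\<close>
  columns. \<open>R 0\<close> carries only the column and \<open>R L\<close> only the row, so both
  come out of the determinants.\<close>

lemma rect_sum_duality:
  fixes R :: "nat \<Rightarrow> 'a :: comm_ring_1 \<Rightarrow> 'b :: field"
  assumes L: "L = 2 * s + 1"
    and R: "\<And>k x. R k x \<noteq> 0"
    and R_dual: "\<And>k x. k \<le> L \<Longrightarrow> R (L - k) (x + of_nat L - 2 * of_nat k) = R k x"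
    and \<sigma>_dual: "\<And>c. c \<in> {1..L} \<Longrightarrow> \<sigma> (Suc L - c) = \<sigma> c"
    and \<sigma>_sq: "\<And>c. \<sigma> c * \<sigma> c = 1"
    and \<sigma>_prod: "(\<Prod>c = 1..L. \<sigma> c) = 1"
    and y: "\<And>c x. y c x = \<sigma> c * R c x / R (c - 1) (x - 2)"
  shows "rect_sum y L m (s + 1) u * (\<Prod>i<m. R 0 (u - of_nat s + of_nat m - 2 * of_nat i - 3)) =
    rect_sum y L m s u * (\<Prod>i<m. R L (u + of_nat s + of_nat m - 2 * of_nat i - 1))"
proof -
  let ?v = "\<lambda>j. u - of_nat s + of_nat m - 2 * of_nat j - 3"
  let ?w = "\<lambda>i. u - of_nat s + of_nat m - 2 * of_nat i - 2"
  let ?f = "\<lambda>i j. esum y L (int (s + 1) - int i + int j) (?v j)"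
  let ?g = "\<lambda>i j. esum y L (int s - int i + int j) (?w j)"
  let ?r = "\<lambda>i. R L (u + of_nat s + of_nat m - 2 * of_nat i - 1)"
  have entry: "?f i j * R 0 (?v j) = ?g j i * ?r i" for i j
  proof -
    let ?n = "int (s + 1) - int i + int j"
    have 1: "int L - ?n = int s - int j + int i"
      using L by simp
    have 2: "u + of_nat s + of_nat m - 2 * of_nat i - 1 - of_nat L = ?w i"
      using L by (simp add: algebra_simps)
    have 3: "?v j + 2 * of_int ?n = u + of_nat s + of_nat m - 2 * of_nat i - 1"
      by (simp add: algebra_simps)
    have "esum y L (int L - ?n) (?v j + 2 * of_int ?n - of_nat L) * R L (?v j + 2 * of_int ?n) =
        esum y L ?n (?v j) * R 0 (?v j)"
      by (rule esum_duality[OF R R_dual \<sigma>_dual \<sigma>_sq \<sigma>_prod y])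
    then show ?thesis unfolding 1 3 2 by (rule sym)
  qed
  have "rect_sum y L m (s + 1) u * (\<Prod>i<m. R 0 (?v i)) = fdet m (\<lambda>i j. ?f i j * R 0 (?v j))"
  proof -
    have "u - of_nat (s + 1) + of_nat m - 2 * of_nat j - 2 = ?v j" for j
      by simp
    then show ?thesis unfolding fdet_scale_columns rect_sum_eq_fdet by (simp only: mult.commute)
  qed
  also have "\<dots> = fdet m (\<lambda>i j. ?g j i * ?r i)"
    unfolding entry ..
  also have "\<dots> = fdet m (\<lambda>i j. ?g i j * ?r j)"
    by (rule fdet_transpose)
  also have "\<dots> = rect_sum y L m s u * (\<Prod>i<m. ?r i)"
    unfolding fdet_scale_columns rect_sum_eq_fdet by (simp add: mult.commute)
  finally show ?thesis .
qed

section \<open>Boxes as weights\<close>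

definition decode :: "nat \<Rightarrow> nat \<Rightarrow> letter" where
  "decode s c = (if c \<le> s then Pos c else if c = s + 1 then Zero else Bar (2 * s + 2 - c))"

fun encode :: "nat \<Rightarrow> letter \<Rightarrow> nat" where
  "encode s (Pos a) = a"
| "encode s Zero = s + 1"
| "encode s (Bar a) = 2 * s + 2 - a"

lemma decode_in_letters:
  assumes "c \<in> {1..2 * s + 1}"
  shows "decode s c \<in> letters s"
proof -
  consider "c \<le> s" | "c = s + 1" | "c > s + 1" by linarith
  then show ?thesis
  proof cases
    case 3
    then have "2 * s + 2 - c \<in> {1..s}" using assms by auto
    then have "Bar (2 * s + 2 - c) \<in> letters s" unfolding letters_def by blast
    with 3 show ?thesis by (simp add: decode_def)
  qed (use assms in \<open>auto simp: decode_def letters_def\<close>)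
qed

lemma encode_range: "x \<in> letters s \<Longrightarrow> encode s x \<in> {1..2 * s + 1}"
  by (auto simp: letters_def)

lemma decode_encode: "x \<in> letters s \<Longrightarrow> decode s (encode s x) = x"
  by (auto simp: letters_def decode_def)

lemma encode_decode: "c \<in> {1..2 * s + 1} \<Longrightarrow> encode s (decode s c) = c"
  by (auto simp: decode_def)

lemma encode_less_iff:
  "x \<in> letters s \<Longrightarrow> y \<in> letters s \<Longrightarrow> encode s x < encode s y \<longleftrightarrow> x \<prec> y"
  by (auto simp: letters_def)

lemma encode_le_iff:
  assumes "x \<in> letters s" "y \<in> letters s"
  shows "encode s x \<le> encode s y \<longleftrightarrow> x \<preceq> y"
proof -
  have "encode s x = encode s y \<longleftrightarrow> x = y"
    using assms by (metis decode_encode)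
  then show ?thesis
    using encode_less_iff[OF assms] by (simp only: letter_le_def le_less disj_commute)
qed

text \<open>\<open>encode\<close> is an order isomorphism, so it respects both monotonicity
  conditions; moving cell \<open>(Suc i, Suc j)\<close> to \<open>(i, j)\<close> preserves
  contents.\<close>

lemma sum_fillings_eq_rect_sum:
  fixes f :: "letter \<Rightarrow> complex \<Rightarrow> complex"
  shows "(\<Sum>b\<in>fillings s m n. \<Prod>i=1..m. \<Prod>j=1..n.
      f (b (i, j)) (u - of_nat n + of_nat m - 2 * of_nat i + 2 * of_nat j)) =
    rect_sum (\<lambda>c. f (decode s c)) (2 * s + 1) m n u"
proof -
  let ?C = "cells m (\<lambda>_. n)" and ?D = "{1..m} \<times> {1..n}"
  let ?v = "u - of_nat n + of_nat m"
  let ?to = "\<lambda>b. restrict (\<lambda>(i, j). encode s (b (Suc i, Suc j))) ?C"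
  let ?from = "\<lambda>b. restrict (\<lambda>(i, j). decode s (b (i - 1, j - 1))) ?D"
  show ?thesis
    unfolding rect_sum_def tableau_sum_def
  proof (rule sum.reindex_bij_witness[where i = ?from and j = ?to])
    fix b assume b: "b \<in> fillings s m n"
    have PiE: "b \<in> ?D \<rightarrow>\<^sub>E letters s"
      using b by (simp add: fillings_def)
    have ext: "b p = undefined" if "p \<notin> ?D" for p
      using PiE_arb[OF PiE that] .
    have lett: "b (i, j) \<in> letters s" if "i \<in> {1..m}" "j \<in> {1..n}" for i j
      using PiE_mem[OF PiE, of "(i, j)"] that by simp
    have row: "b (i, j) \<prec> b (i, j + 1)" if "i \<in> {1..m}" "j \<in> {1..<n}" for i j
      using b that by (simp add: fillings_def)
    have col: "b (i, j) \<preceq> b (i + 1, j)" if "i \<in> {1..<m}" "j \<in> {1..n}" for i j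
      using b that by (simp add: fillings_def)
    show "?from (?to b) = b"
    proof
      fix p
      show "?from (?to b) p = b p"
        using ext[of p] lett by (cases p) (auto simp: cells_def decode_encode)
    qed
    show "?to b \<in> tableaux m (\<lambda>_. n) (2 * s + 1)"
      unfolding tableaux_def
    proof (intro CollectI conjI allI impI)
      show "?to b \<in> ?C \<rightarrow>\<^sub>E {1..2 * s + 1}"
      proof (rule PiE_I)
        fix p assume "p \<in> ?C"
        then obtain i j where p: "p = (i, j)" "i < m" "j < n" by (auto simp: cells_def)
        then show "?to b p \<in> {1..2 * s + 1}"
          using encode_range[OF lett[of "Suc i" "Suc j"]] by (simp add: cells_def)
      qed simp
    next
      fix i j assume ij: "i < m" "Suc j < n"
      then have "b (Suc i, Suc j) \<prec> b (Suc i, Suc j + 1)"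
        using row[of "Suc i" "Suc j"] by simp
      then show "?to b (i, j) < ?to b (i, Suc j)"
        using ij encode_less_iff[OF lett lett] by (simp add: cells_def)
    next
      fix i j assume ij: "Suc i < m" "j < n"
      then have "b (Suc i, Suc j) \<preceq> b (Suc i + 1, Suc j)"
        using col[of "Suc i" "Suc j"] by simp
      then show "?to b (i, j) \<le> ?to b (Suc i, j)"
        using ij encode_le_iff[OF lett lett] by (simp add: cells_def)
    qed
    have "(\<Prod>(i, j)\<in>?C. f (decode s (?to b (i, j))) (?v + 2 * of_nat j - 2 * of_nat i)) =
        (\<Prod>(i, j)\<in>?D. f (b (i, j)) (?v - 2 * of_nat i + 2 * of_nat j))"
    proof (rule prod.reindex_bij_witness[where i = "\<lambda>(i, j). (i - 1, j - 1)"
          and j = "\<lambda>(i, j). (Suc i, Suc j)"])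
      fix p assume "p \<in> ?C"
      then show "(case case p of (i, j) \<Rightarrow> (Suc i, Suc j) of (i, j) \<Rightarrow> f (b (i, j)) (?v - 2 * of_nat i + 2 * of_nat j)) =
         (case p of (i, j) \<Rightarrow> f (decode s (?to b (i, j))) (?v + 2 * of_nat j - 2 * of_nat i))"
        using lett decode_encode by (cases p) (auto simp: cells_def algebra_simps)
    qed (auto simp: cells_def)
    then show "(\<Prod>(i, j)\<in>?C. f (decode s (?to b (i, j))) (?v + 2 * of_nat j - 2 * of_nat i)) =
        (\<Prod>i=1..m. \<Prod>j=1..n. f (b (i, j)) (?v - 2 * of_nat i + 2 * of_nat j))"
      by (simp add: prod.cartesian_product)
  next
    fix b assume b: "b \<in> tableaux m (\<lambda>_. n) (2 * s + 1)"
    have ext: "b p = undefined" if "p \<notin> ?C" for p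
      using b that PiE_arb[of b ?C "\<lambda>_. {1..2 * s + 1}" p] by (simp add: tableaux_def)
    have rng: "b (i, j) \<in> {1..2 * s + 1}" if "i < m" "j < n" for i j
      using tableaux_range[OF b that] by simp
    have col: "b (i, j) \<le> b (Suc i, j)" if "Suc i < m" "j < n" for i j
      using b that by (simp add: tableaux_def)
    show "?to (?from b) = b"
    proof
      fix p
      show "?to (?from b) p = b p"
      proof (cases p)
        case (Pair i j)
        show ?thesis
        proof (cases "i < m \<and> j < n")
          case True
          then show ?thesis using encode_decode[OF rng[of i j]] by (simp add: Pair cells_def)
        next
          case False
          then have "p \<notin> ?C" by (simp add: Pair cells_def)
          then show ?thesis using ext[of p] by simp
        qed
      qed
    qed
    define c where "c = ?from b"
    have from_lett: "c (i, j) \<in> letters s"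
        and enc: "encode s (c (i, j)) = b (i - 1, j - 1)"
      if "1 \<le> i" "i \<le> m" "1 \<le> j" "j \<le> n" for i j
      using that decode_in_letters[OF rng[of "i - 1" "j - 1"]] encode_decode[OF rng[of "i - 1" "j - 1"]]
      by (auto simp: c_def)
    have "c \<in> fillings s m n"
      unfolding fillings_def
    proof (intro CollectI conjI ballI)
      show "c \<in> ?D \<rightarrow>\<^sub>E letters s"
      proof (rule PiE_I)
        fix p assume "p \<in> ?D"
        then obtain i j where "p = (i, j)" "1 \<le> i" "i \<le> m" "1 \<le> j" "j \<le> n" by auto
        then show "c p \<in> letters s" using from_lett[of i j] by simp
      qed (simp add: c_def restrict_def)
    next
      fix i j assume ij: "i \<in> {1..m}" "j \<in> {1..<n}"
      then have h: "1 \<le> i" "i \<le> m" "1 \<le> j" "j \<le> n" "1 \<le> j + 1" "j + 1 \<le> n" by auto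
      then have "b (i - 1, j - 1) < b (i - 1, j)"
        using tableaux_row_less[OF b, of "i - 1" "j - 1" j] by auto
      then show "c (i, j) \<prec> c (i, j + 1)"
        using encode_less_iff[OF from_lett[OF h(1-4)] from_lett[OF h(1,2,5,6)]]
          enc[OF h(1-4)] enc[OF h(1,2,5,6)] by simp
    next
      fix i j assume ij: "i \<in> {1..<m}" "j \<in> {1..n}"
      then have h: "1 \<le> i" "i \<le> m" "1 \<le> j" "j \<le> n" "1 \<le> i + 1" "i + 1 \<le> m" by auto
      then have "b (i - 1, j - 1) \<le> b (Suc (i - 1), j - 1)"
        using ij by (intro col) auto
      then show "c (i, j) \<preceq> c (i + 1, j)"
        using encode_le_iff[OF from_lett[OF h(1-4)] from_lett[OF h(5,6,3,4)]]
          enc[OF h(1-4)] enc[OF h(5,6,3,4)] h by simp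
    qed
    then show "?from b \<in> fillings s m n" by (simp only: c_def)
  qed
qed

text \<open>
  Numbering the letters by \<open>1, \<dots>, 2 s + 1\<close> and putting \<open>\<phi>\<close> at both ends of the chain of \<open>Q\<close>-functions
  gives all boxes the same shape: the exceptional factors of \<open>psi\<close> for the first and last letter are
  those coming from \<open>\<phi>\<close> in the positions \<open>0\<close> and \<open>2 s + 1\<close>.
\<close>

definition q_fun :: "nat \<Rightarrow> (complex \<Rightarrow> complex) \<Rightarrow> (nat \<Rightarrow> complex \<Rightarrow> complex) \<Rightarrow> nat \<Rightarrow> complex \<Rightarrow> complex" where
  "q_fun s \<phi> Q k = (if k = 0 \<or> k > 2 * s then \<phi> else if k \<le> s then Q k else Q (2 * s + 1 - k))"

text \<open>The shift by \<open>k\<close> makes the reflection work: replacing \<open>k\<close> by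
  \<open>2 s + 1 - k\<close> and \<open>u\<close> by \<open>u + (2 s + 1) - 2 k\<close> leaves
  \<open>u - k\<close> unchanged.\<close>

definition R_fun :: "nat \<Rightarrow> (complex \<Rightarrow> complex) \<Rightarrow> (nat \<Rightarrow> complex \<Rightarrow> complex) \<Rightarrow> nat \<Rightarrow> complex \<Rightarrow> complex" where
  "R_fun s \<phi> Q k u = q_fun s \<phi> Q k (u - of_nat k + 2) / q_fun s \<phi> Q k (u - of_nat k)"

definition letter_sign :: "nat \<Rightarrow> nat \<Rightarrow> complex" where
  "letter_sign s c = (if c = s + 1 then 1 else -1)"

definition z_fun :: "nat \<Rightarrow> (complex \<Rightarrow> complex) \<Rightarrow> (nat \<Rightarrow> complex \<Rightarrow> complex) \<Rightarrow> nat \<Rightarrow> complex \<Rightarrow> complex" where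
  "z_fun s \<phi> Q c u = letter_sign s c * R_fun s \<phi> Q c u / R_fun s \<phi> Q (c - 1) (u - 2)"

text \<open>Nowhere vanishing data make every quotient a genuine one, so identities hold at each
  \<open>u\<close>. The products of \<open>\<Phi>\<close> in the theorem can vanish; the locale is
  instantiated with modifications of them.\<close>

locale vacuum =
  fixes s :: nat and \<phi> :: "complex \<Rightarrow> complex" and Q :: "nat \<Rightarrow> complex \<Rightarrow> complex"
  assumes s: "s \<ge> 1" and \<phi>: "\<And>u. \<phi> u \<noteq> 0" and Q: "\<And>a u. Q a u \<noteq> 0" and Q0: "\<And>u. Q 0 u = 1"
begin

lemma q_fun_nonzero: "q_fun s \<phi> Q k u \<noteq> 0"
  by (simp add: q_fun_def \<phi> Q)

lemma R_fun_nonzero: "R_fun s \<phi> Q k u \<noteq> 0"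
  by (simp add: R_fun_def q_fun_nonzero)

lemma q_fun_reflect: "k \<le> 2 * s + 1 \<Longrightarrow> q_fun s \<phi> Q (2 * s + 1 - k) = q_fun s \<phi> Q k"
  by (auto simp: q_fun_def)

lemma R_fun_reflect:
  assumes "k \<le> 2 * s + 1"
  shows "R_fun s \<phi> Q (2 * s + 1 - k) (x + of_nat (2 * s + 1) - 2 * of_nat k) = R_fun s \<phi> Q k x"
proof -
  have "x + of_nat (2 * s + 1) - 2 * of_nat k - of_nat (2 * s + 1 - k) = x - of_nat k"
    by (simp only: of_nat_diff[OF assms]) simp
  then show ?thesis unfolding R_fun_def q_fun_reflect[OF assms] by (simp only:)
qed

text \<open>At the ends: for \<open>c = 1\<close>, dividing by \<open>R_fun\<close> at index 0,
  which is \<open>\<phi> u / \<phi> (u - 2)\<close>, trades \<open>\<phi> u\<close> for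
  \<open>\<phi> (u - 2)\<close>. For \<open>c = 2 s + 1\<close>, the factor
  \<open>\<phi> (u - 2 s + 1) / \<phi> (u - 2 s - 1)\<close> does the same to the second
  \<open>\<phi>\<close>.\<close>

lemma signed_box:
  assumes c: "c \<in> {1..2 * s + 1}"
  shows "(-1) ^ parity (decode s c) * box s \<phi> Q (decode s c) u =
    \<phi> u * \<phi> (u - 2 * of_nat s - 1) * z_fun s \<phi> Q c u"
proof -
  consider "c = 1" | "1 < c" "c \<le> s" | "c = s + 1" | "s + 1 < c" "c < 2 * s + 1" | "c = 2 * s + 1"
    using c by fastforce
  then show ?thesis
  proof cases
    case 1
    with s show ?thesis
      by (simp add: decode_def psi_def z_fun_def R_fun_def q_fun_def letter_sign_def Q0 \<phi> Q field_simps)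
  next
    case 2
    then obtain d where d: "c = Suc (Suc d)" by (metis One_nat_def Suc_le_D less_imp_le_nat Suc_le_mono Suc_leI)
    from 2 show ?thesis
      unfolding d by (simp add: decode_def psi_def z_fun_def R_fun_def q_fun_def letter_sign_def Q0 \<phi> Q field_simps)
  next
    case 3
    with s show ?thesis
      by (simp add: decode_def psi_def z_fun_def R_fun_def q_fun_def letter_sign_def Q0 \<phi> Q field_simps)
  next
    case 4
    define a where "a = 2 * s + 2 - c"
    have a: "1 < a" "a \<le> s" "c = 2 * s + 2 - a" using 4 by (auto simp: a_def)
    have dec: "decode s c = Bar a" using 4 a by (simp add: decode_def)
    have c': "(of_nat c :: complex) = 2 * of_nat s + 2 - of_nat a"
      "(of_nat (c - 1) :: complex) = 2 * of_nat s + 1 - of_nat a"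
      using a by (simp_all add: of_nat_diff)
    have q: "q_fun s \<phi> Q c = Q (a - 1)" "q_fun s \<phi> Q (c - 1) = Q a"
      using 4 a by (auto simp: q_fun_def)
    have args: "u - 2 * of_nat s + of_nat a - 2 + 2 = u - 2 * of_nat s + of_nat a"
      "u - (2 * of_nat s + 2 - of_nat a) = u - 2 * of_nat s + of_nat a - 2"
      "u - 2 * of_nat s + of_nat a - 3 + 2 = u - 2 * of_nat s + of_nat a - 1"
      "u - 2 - (2 * of_nat s + 1 - of_nat a) = u - 2 * of_nat s + of_nat a - 3"
      by simp_all
    have p: "psi s \<phi> (Bar a) u = \<phi> u * \<phi> (u - 2 * of_nat s - 1)"
      using a by (simp add: psi_def)
    have sgn: "letter_sign s c = -1" using 4 by (simp add: letter_sign_def)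
    show ?thesis
      unfolding dec z_fun_def R_fun_def q c' args box.simps p sgn by simp
  next
    case 5
    have dec: "decode s c = Bar 1" using 5 s by (simp add: decode_def)
    have q: "q_fun s \<phi> Q c = \<phi>" "q_fun s \<phi> Q (c - 1) = Q 1"
      using 5 s by (auto simp: q_fun_def)
    show ?thesis
      unfolding dec z_fun_def R_fun_def q using 5 s
      by (simp add: psi_def letter_sign_def Q0 \<phi> Q field_simps)
  qed
qed

end

section \<open>Normalization\<close>

lemma tableau_sum_factor:
  fixes y z :: "nat \<Rightarrow> 'a :: comm_ring_1 \<Rightarrow> 'b :: comm_ring_1"
  assumes "\<And>c x. c \<in> {1..k} \<Longrightarrow> y c x = P x * z c x"
  shows "tableau_sum y m l k v =
    (\<Prod>(i, j)\<in>cells m l. P (v + 2 * of_nat j - 2 * of_nat i)) * tableau_sum z m l k v"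
  unfolding tableau_sum_def sum_distrib_left
proof (rule sum.cong[OF refl])
  fix b assume b: "b \<in> tableaux m l k"
  have "(\<Prod>(i, j)\<in>cells m l. y (b (i, j)) (v + 2 * of_nat j - 2 * of_nat i)) =
    (\<Prod>p\<in>cells m l. (case p of (i, j) \<Rightarrow> P (v + 2 * of_nat j - 2 * of_nat i)) *
       (case p of (i, j) \<Rightarrow> z (b (i, j)) (v + 2 * of_nat j - 2 * of_nat i)))"
  proof (rule prod.cong[OF refl])
    fix p assume p: "p \<in> cells m l"
    then obtain i j where ij: "p = (i, j)" "i < m" "j < l i" by (auto simp: cells_def)
    then show "(case p of (i, j) \<Rightarrow> y (b (i, j)) (v + 2 * of_nat j - 2 * of_nat i)) =
      (case p of (i, j) \<Rightarrow> P (v + 2 * of_nat j - 2 * of_nat i)) *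
       (case p of (i, j) \<Rightarrow> z (b (i, j)) (v + 2 * of_nat j - 2 * of_nat i))"
      using assms[of "b (i, j)"] tableaux_range[OF b, of i j] by simp
  qed
  then show "(\<Prod>(i, j)\<in>cells m l. y (b (i, j)) (v + 2 * of_nat j - 2 * of_nat i)) =
    (\<Prod>(i, j)\<in>cells m l. P (v + 2 * of_nat j - 2 * of_nat i)) *
    (\<Prod>(i, j)\<in>cells m l. z (b (i, j)) (v + 2 * of_nat j - 2 * of_nat i))"
    by (simp only: prod.distrib)
qed

lemma norm_F_Suc:
  "norm_F s \<phi> (Suc n) x =
    (\<Prod>j<n. \<phi> (x - of_nat n + 2 * of_nat j + 2) * \<phi> (x - 2 * of_nat s - of_nat n + 2 * of_nat j - 1))"
proof -
  have "norm_F s \<phi> (Suc n) x = (\<Prod>j<n. \<phi> (x - of_nat (Suc n) + 2 * of_nat (Suc j) + 1) *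
      \<phi> (x - 2 * of_nat s - of_nat (Suc n) + 2 * of_nat (Suc j) - 2))"
    unfolding norm_F_def One_nat_def prod.atLeast_Suc_lessThan_Suc_shift
    by (simp only: o_def atLeast0LessThan)
  also have "\<dots> = (\<Prod>j<n. \<phi> (x - of_nat n + 2 * of_nat j + 2) *
      \<phi> (x - 2 * of_nat s - of_nat n + 2 * of_nat j - 1))"
    by (rule prod.cong[OF refl]) (simp add: algebra_simps)
  finally show ?thesis .
qed

text \<open>Both families of \<open>\<phi>\<close> run through \<open>n\<close> points in steps of
  2, whereas \<open>norm_F\<close> has only \<open>n - 1\<close> of each: the first point of one
  family and the last point of the other are left over.\<close>

lemma prod_row_eq_norm_F:
  assumes "n \<ge> 1"
  shows "(\<Prod>j<n. \<phi> (x - of_nat n + 1 + 2 * of_nat j) * \<phi> (x - of_nat n + 1 + 2 * of_nat j - 2 * of_nat s - 1)) =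
    norm_F s \<phi> n x * (\<phi> (x - of_nat n + 1) * \<phi> (x + of_nat n - 2 * of_nat s - 2))"
proof -
  obtain k where n: "n = Suc k" using assms by (cases n) auto
  have 1: "(\<Prod>j<n. \<phi> (x - of_nat n + 1 + 2 * of_nat j)) =
      \<phi> (x - of_nat n + 1) * (\<Prod>j<k. \<phi> (x - of_nat k + 2 * of_nat j + 2))"
    unfolding n prod.lessThan_Suc_shift by (simp add: add.commute add.left_commute diff_add_eq)
  have 2: "(\<Prod>j<n. \<phi> (x - of_nat n + 1 + 2 * of_nat j - 2 * of_nat s - 1)) =
      (\<Prod>j<k. \<phi> (x - 2 * of_nat s - of_nat k + 2 * of_nat j - 1)) *
      \<phi> (x + of_nat n - 2 * of_nat s - 2)"
    unfolding n prod.lessThan_Suc by (simp add: algebra_simps)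
  show ?thesis
    unfolding prod.distrib 1 2 unfolding n norm_F_Suc prod.distrib by (simp only: mult_ac)
qed

text \<open>The right side is the \<open>boundary_factor\<close> of width 0, with the order of the
  factors reversed. This is where the \<open>g\<close> functions come from.\<close>

lemma prod_T_zero:
  "(\<Prod>j=1..k. T_zero s \<phi> (u + 2 * of_nat j - of_nat k - 1)) =
    (\<Prod>i<k. \<phi> (u + of_nat k - 2 * of_nat i) * \<phi> (u + of_nat k - 2 * of_nat i - 2 * of_nat s - 3))"
proof (rule prod.reindex_bij_witness[where i = "\<lambda>i. k - i" and j = "\<lambda>j. k - j"])
  fix j assume j: "j \<in> {1..k}"
  show "\<phi> (u + of_nat k - 2 * of_nat (k - j)) * \<phi> (u + of_nat k - 2 * of_nat (k - j) - 2 * of_nat s - 3) =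
    T_zero s \<phi> (u + 2 * of_nat j - of_nat k - 1)"
    unfolding T_zero_def
    by (intro arg_cong2[where f = "(*)"] arg_cong[where f = \<phi>]) (use j in \<open>simp_all add: of_nat_diff\<close>)
qed auto

text \<open>
  The factors \<open>\<phi> u * \<phi> (u - 2 s - 1)\<close> of the boxes multiply up to the normalization \<open>norm_F\<close> of each
  row, except for one extra factor at either end of the row; these are collected here.
\<close>

definition boundary_factor :: "nat \<Rightarrow> (complex \<Rightarrow> complex) \<Rightarrow> nat \<Rightarrow> nat \<Rightarrow> complex \<Rightarrow> complex" where
  "boundary_factor s \<phi> m n u = (\<Prod>i<m. \<phi> (u + of_nat m - 2 * of_nat i - of_nat n) *
     \<phi> (u + of_nat m - 2 * of_nat i + of_nat n - 2 * of_nat s - 3))"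

text \<open>Two strings of \<open>m\<close> points around \<open>u - 1\<close> and
  \<open>u + 1\<close> become strings of lengths \<open>m - 1\<close> and \<open>m + 1\<close>
  around \<open>u\<close> by moving the lowest point \<open>u - m + 1\<close>. Together with the
  next lemma, all three terms of the bilinear relation carry the same factor, so the relation
  survives the normalization.\<close>

lemma boundary_factor_rows:
  assumes "m \<ge> 1"
  shows "boundary_factor s \<phi> m n (u - 1) * boundary_factor s \<phi> m n (u + 1) =
    boundary_factor s \<phi> (m - 1) n u * boundary_factor s \<phi> (m + 1) n u"
proof -
  obtain k where m: "m = Suc k" using assms by (cases m) auto
  define a where "a w = \<phi> (w - of_nat n) * \<phi> (w + of_nat n - 2 * of_nat s - 3)" for w
  have a: "boundary_factor s \<phi> m n u = (\<Prod>i<m. a (u + of_nat m - 2 * of_nat i))" for m u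
    by (simp add: boundary_factor_def a_def)
  have 1: "boundary_factor s \<phi> m n (u - 1) = boundary_factor s \<phi> k n u * a (u - of_nat k)"
    unfolding a m by (simp add: algebra_simps)
  have 2: "boundary_factor s \<phi> (m + 1) n u = boundary_factor s \<phi> m n (u + 1) * a (u - of_nat k)"
    unfolding a m by (simp add: algebra_simps)
  show ?thesis unfolding 1 2 by (simp add: m mult_ac)
qed

lemma boundary_factor_columns:
  assumes "n \<ge> 1"
  shows "boundary_factor s \<phi> m n (u - 1) * boundary_factor s \<phi> m n (u + 1) =
    boundary_factor s \<phi> m (n - 1) u * boundary_factor s \<phi> m (n + 1) u"
proof -
  have n: "(of_nat (n - 1) :: complex) = of_nat n - 1" using assms by (simp add: of_nat_diff)
  show ?thesis
    unfolding boundary_factor_def prod.distrib[symmetric] n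
    by (rule prod.cong[OF refl]) (simp add: algebra_simps)
qed

context vacuum
begin

text \<open>For \<open>n = 0\<close> this is not \<open>rect_T_norm\<close> but the product of
  \<open>T_zero\<close> factors, so that the relation for \<open>n = 1\<close> contains the right
  \<open>g\<close>.\<close>

definition norm_sum :: "nat \<Rightarrow> nat \<Rightarrow> complex \<Rightarrow> complex" where
  "norm_sum m n u = rect_sum (z_fun s \<phi> Q) (2 * s + 1) m n u * boundary_factor s \<phi> m n u"

lemma norm_F_nonzero: "norm_F s \<phi> n x \<noteq> 0"
  by (simp add: norm_F_def \<phi>)

lemma rect_T_norm_eq_norm_sum:
  assumes n: "n \<ge> 1"
  shows "rect_T_norm s \<phi> Q m n u = norm_sum m n u"
proof -
  let ?P = "\<lambda>w. \<phi> w * \<phi> (w - 2 * of_nat s - 1)"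
  let ?F = "\<Prod>i<m. norm_F s \<phi> n (u + of_nat m - 2 * of_nat i - 1)"
  have "rect_T s \<phi> Q m n u =
      rect_sum (\<lambda>c w. (-1) ^ parity (decode s c) * box s \<phi> Q (decode s c) w) (2 * s + 1) m n u"
    unfolding rect_T_def by (rule sum_fillings_eq_rect_sum)
  also have "\<dots> = (\<Prod>(i, j)\<in>cells m (\<lambda>_. n). ?P (u - of_nat n + of_nat m + 2 * of_nat j - 2 * of_nat i)) *
      rect_sum (z_fun s \<phi> Q) (2 * s + 1) m n u"
    unfolding rect_sum_def by (rule tableau_sum_factor) (rule signed_box)
  also have "(\<Prod>(i, j)\<in>cells m (\<lambda>_. n). ?P (u - of_nat n + of_nat m + 2 * of_nat j - 2 * of_nat i)) =
      (\<Prod>i<m. \<Prod>j<n. ?P (u - of_nat n + of_nat m + 2 * of_nat j - 2 * of_nat i))"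
    unfolding cells_def by (subst prod.Sigma) auto
  also have "\<dots> = (\<Prod>i<m. norm_F s \<phi> n (u + of_nat m - 2 * of_nat i - 1) *
      (\<phi> (u + of_nat m - 2 * of_nat i - of_nat n) *
       \<phi> (u + of_nat m - 2 * of_nat i + of_nat n - 2 * of_nat s - 3)))"
  proof (rule prod.cong[OF refl])
    fix i
    let ?x = "u + of_nat m - 2 * of_nat i - 1 :: complex"
    have "u - of_nat n + of_nat m + 2 * of_nat j - 2 * of_nat i = ?x - of_nat n + 1 + 2 * of_nat j" for j
      by simp
    then have "(\<Prod>j<n. ?P (u - of_nat n + of_nat m + 2 * of_nat j - 2 * of_nat i)) =
        (\<Prod>j<n. ?P (?x - of_nat n + 1 + 2 * of_nat j))"
      by (simp only:)
    also have "\<dots> = norm_F s \<phi> n ?x * (\<phi> (?x - of_nat n + 1) * \<phi> (?x + of_nat n - 2 * of_nat s - 2))"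
      by (rule prod_row_eq_norm_F[OF n])
    also have "?x - of_nat n + 1 = u + of_nat m - 2 * of_nat i - of_nat n" by simp
    also have "?x + of_nat n - 2 * of_nat s - 2 = u + of_nat m - 2 * of_nat i + of_nat n - 2 * of_nat s - 3"
      by simp
    finally show "(\<Prod>j<n. ?P (u - of_nat n + of_nat m + 2 * of_nat j - 2 * of_nat i)) =
      norm_F s \<phi> n ?x * (\<phi> (u + of_nat m - 2 * of_nat i - of_nat n) *
       \<phi> (u + of_nat m - 2 * of_nat i + of_nat n - 2 * of_nat s - 3))" .
  qed
  also have "\<dots> = ?F * boundary_factor s \<phi> m n u"
    unfolding prod.distrib boundary_factor_def ..
  finally have T: "rect_T s \<phi> Q m n u = ?F * norm_sum m n u"
    by (simp add: norm_sum_def mult_ac)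
  have "(\<Prod>j=1..m. norm_F s \<phi> n (u + of_nat m - 2 * of_nat j + 1)) = ?F"
    by (rule prod.reindex_bij_witness[where i = Suc and j = "\<lambda>j. j - 1"])
       (auto simp: of_nat_diff algebra_simps)
  moreover have "?F \<noteq> 0" by (simp add: norm_F_nonzero)
  ultimately show ?thesis by (simp add: rect_T_norm_def T)
qed

lemma norm_sum_t_system:
  assumes "m \<ge> 1" "n \<ge> 1"
  shows "norm_sum m n (u - 1) * norm_sum m n (u + 1) =
    norm_sum (m - 1) n u * norm_sum (m + 1) n u + norm_sum m (n - 1) u * norm_sum m (n + 1) u"
proof -
  let ?r = "rect_sum (z_fun s \<phi> Q) (2 * s + 1)" and ?b = "boundary_factor s \<phi>"
  have "norm_sum m n (u - 1) * norm_sum m n (u + 1) =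
      (?r m n (u - 1) * ?r m n (u + 1)) * (?b m n (u - 1) * ?b m n (u + 1))"
    by (simp add: norm_sum_def mult_ac)
  also have "\<dots> = ?r (m - 1) n u * ?r (m + 1) n u * (?b m n (u - 1) * ?b m n (u + 1)) +
      ?r m (n - 1) u * ?r m (n + 1) u * (?b m n (u - 1) * ?b m n (u + 1))"
    by (simp only: rect_sum_t_system[OF assms] distrib_right)
  also have "?r (m - 1) n u * ?r (m + 1) n u * (?b m n (u - 1) * ?b m n (u + 1)) =
      norm_sum (m - 1) n u * norm_sum (m + 1) n u"
    unfolding boundary_factor_rows[OF assms(1)] norm_sum_def by (simp only: mult_ac)
  also have "?r m (n - 1) u * ?r m (n + 1) u * (?b m n (u - 1) * ?b m n (u + 1)) =
      norm_sum m (n - 1) u * norm_sum m (n + 1) u"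
    unfolding boundary_factor_columns[OF assms(2)] norm_sum_def by (simp only: mult_ac)
  finally show ?thesis .
qed

lemma norm_sum_no_rows: "norm_sum 0 n u = 1"
  by (simp add: norm_sum_def rect_sum_no_cells boundary_factor_def)

lemma norm_sum_no_columns: "norm_sum m 0 u = (\<Prod>j=1..m. T_zero s \<phi> (u + 2 * of_nat j - of_nat m - 1))"
  unfolding prod_T_zero norm_sum_def boundary_factor_def by (simp add: rect_sum_no_cells)

lemma prod_letter_sign: "(\<Prod>c = 1..2 * s + 1. letter_sign s c) = 1"
proof -
  have "(\<Prod>c = 1..2 * s + 1. letter_sign s c) =
      letter_sign s (s + 1) * (\<Prod>c\<in>{1..2 * s + 1} - {s + 1}. letter_sign s c)"
    by (rule prod.remove) auto
  also have "(\<Prod>c\<in>{1..2 * s + 1} - {s + 1}. letter_sign s c) = (\<Prod>c\<in>{1..2 * s + 1} - {s + 1}. -1)"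
    by (rule prod.cong) (auto simp: letter_sign_def)
  also have "\<dots> = (1 :: complex)" by simp
  finally show ?thesis by (simp add: letter_sign_def)
qed

lemma norm_sum_duality: "norm_sum m (s + 1) u = norm_sum m s u"
proof -
  let ?r = "rect_sum (z_fun s \<phi> Q) (2 * s + 1)" and ?R = "R_fun s \<phi> Q"
  let ?w = "\<lambda>i. u - of_nat s + of_nat m - 2 * of_nat i :: complex"
  \<comment> \<open>Common denominator of the two end factors, which are
    \<open>\<phi> (?w i - 1) / \<phi> (?w i - 3)\<close> and
    \<open>\<phi> (?w i) / \<phi> (?w i - 2)\<close>. Clearing it gives the boundary factors of
    widths \<open>s + 1\<close> and \<open>s\<close>.\<close>
  let ?c = "\<Prod>i<m. \<phi> (?w i - 3) * \<phi> (?w i - 2)"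
  have dual: "?r m (s + 1) u * (\<Prod>i<m. ?R 0 (?w i - 3)) =
      ?r m s u * (\<Prod>i<m. ?R (2 * s + 1) (u + of_nat s + of_nat m - 2 * of_nat i - 1))"
  proof (rule rect_sum_duality[where \<sigma> = "letter_sign s"])
    show "letter_sign s (Suc (2 * s + 1) - c) = letter_sign s c" if "c \<in> {1..2 * s + 1}" for c
      using that by (auto simp: letter_sign_def)
    show "letter_sign s c * letter_sign s c = 1" for c by (simp add: letter_sign_def)
    show "?R (2 * s + 1 - k) (x + of_nat (2 * s + 1) - 2 * of_nat k) = ?R k x" if "k \<le> 2 * s + 1" for k x
      using that by (rule R_fun_reflect)
    show "?R k x \<noteq> 0" for k x by (rule R_fun_nonzero)
  qed (simp_all only: prod_letter_sign z_fun_def)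
  have args0: "?w i - 3 + 2 = ?w i - 1" "?w i - 3 - of_nat 0 = ?w i - 3" for i
    by simp_all
  have R0: "?R 0 (?w i - 3) * (\<phi> (?w i - 3) * \<phi> (?w i - 2)) = \<phi> (?w i - 1) * \<phi> (?w i - 2)" for i
    unfolding R_fun_def args0 by (simp add: q_fun_def \<phi>)
  have args: "u + of_nat s + of_nat m - 2 * of_nat i - 1 - of_nat (2 * s + 1) = ?w i - 2"
    "?w i - 2 + 2 = ?w i" for i
    by simp_all
  have RL: "?R (2 * s + 1) (u + of_nat s + of_nat m - 2 * of_nat i - 1) * (\<phi> (?w i - 3) * \<phi> (?w i - 2)) =
      \<phi> (?w i) * \<phi> (?w i - 3)" for i
    unfolding R_fun_def args by (simp add: q_fun_def \<phi>)
  have b1: "boundary_factor s \<phi> m (s + 1) u = (\<Prod>i<m. ?R 0 (?w i - 3)) * ?c"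
    unfolding boundary_factor_def prod.distrib[symmetric] R0
    by (intro prod.cong[OF refl] arg_cong2[where f = "(*)"] arg_cong[where f = \<phi>]) simp_all
  have b2: "boundary_factor s \<phi> m s u =
      (\<Prod>i<m. ?R (2 * s + 1) (u + of_nat s + of_nat m - 2 * of_nat i - 1)) * ?c"
    unfolding boundary_factor_def prod.distrib[symmetric] RL
    by (intro prod.cong[OF refl] arg_cong2[where f = "(*)"] arg_cong[where f = \<phi>]) simp_all
  show ?thesis
    unfolding norm_sum_def b1 b2 using dual by (simp only: mult.assoc[symmetric])
qed

section \<open>The relations for nowhere vanishing data\<close>

lemma T_fun_eq_norm_sum:
  "1 \<le> a \<Longrightarrow> a < s \<Longrightarrow> T_fun s \<phi> Q a k u = norm_sum k a u"
  "T_fun s \<phi> Q s (2 * k) u = norm_sum k s u"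
  using s by (auto simp: T_fun_def rect_T_norm_eq_norm_sum norm_sum_no_rows)

text \<open>For \<open>a = 1\<close> the neighbour of width 0 is 1 by convention and
  \<open>g\<close> supplies its normalization; for larger \<open>a\<close> the function
  \<open>g\<close> is 1.\<close>

lemma g_fun_T_fun:
  assumes "1 \<le> a" "a < s"
  shows "g_fun s \<phi> a k u * T_fun s \<phi> Q (a - 1) k u = norm_sum k (a - 1) u"
proof (cases "a = 1")
  case True
  then show ?thesis using assms by (simp add: g_fun_def T_fun_def norm_sum_no_columns)
next
  case False
  then show ?thesis using assms by (simp add: g_fun_def T_fun_eq_norm_sum)
qed

lemma g_fun_T_fun_last:
  "g_fun s \<phi> s (2 * k) u * T_fun s \<phi> Q (s - 1) k u = norm_sum k (s - 1) u"
proof (cases "s = 1")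
  case True
  then show ?thesis using norm_sum_no_columns[of k u] by (simp add: g_fun_def T_fun_def)
next
  case False
  then show ?thesis using s by (simp add: g_fun_def T_fun_eq_norm_sum)
qed

lemma t_system:
  assumes m: "m \<ge> 1"
  shows "1 \<le> a \<Longrightarrow> a + 2 \<le> s \<Longrightarrow>
      T_fun s \<phi> Q a m (u - 1) * T_fun s \<phi> Q a m (u + 1) =
        T_fun s \<phi> Q a (m - 1) u * T_fun s \<phi> Q a (m + 1) u +
        g_fun s \<phi> a m u * T_fun s \<phi> Q (a - 1) m u * T_fun s \<phi> Q (a + 1) m u"
    and "s \<ge> 2 \<Longrightarrow>
      T_fun s \<phi> Q (s - 1) m (u - 1) * T_fun s \<phi> Q (s - 1) m (u + 1) =
        T_fun s \<phi> Q (s - 1) (m - 1) u * T_fun s \<phi> Q (s - 1) (m + 1) u +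
        g_fun s \<phi> (s - 1) m u * T_fun s \<phi> Q (s - 2) m u * T_fun s \<phi> Q s (2 * m) u"
    and "T_fun s \<phi> Q s (2 * m) (u - 1) * T_fun s \<phi> Q s (2 * m) (u + 1) =
        T_fun s \<phi> Q s (2 * m - 2) u * T_fun s \<phi> Q s (2 * m + 2) u +
        g_fun s \<phi> s (2 * m) u * T_fun s \<phi> Q (s - 1) m u * T_fun s \<phi> Q s (2 * m) u"
proof -
  show "T_fun s \<phi> Q a m (u - 1) * T_fun s \<phi> Q a m (u + 1) =
        T_fun s \<phi> Q a (m - 1) u * T_fun s \<phi> Q a (m + 1) u +
        g_fun s \<phi> a m u * T_fun s \<phi> Q (a - 1) m u * T_fun s \<phi> Q (a + 1) m u"
    if "1 \<le> a" "a + 2 \<le> s"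
    using that g_fun_T_fun[of a] norm_sum_t_system[OF m, of a u] by (simp add: T_fun_eq_norm_sum)
  show "T_fun s \<phi> Q (s - 1) m (u - 1) * T_fun s \<phi> Q (s - 1) m (u + 1) =
        T_fun s \<phi> Q (s - 1) (m - 1) u * T_fun s \<phi> Q (s - 1) (m + 1) u +
        g_fun s \<phi> (s - 1) m u * T_fun s \<phi> Q (s - 2) m u * T_fun s \<phi> Q s (2 * m) u"
    if "s \<ge> 2"
  proof -
    have "g_fun s \<phi> (s - 1) m u * T_fun s \<phi> Q (s - 2) m u = norm_sum m (s - 2) u"
      using g_fun_T_fun[of "s - 1" m u] that by (simp add: numeral_2_eq_2)
    moreover have "T_fun s \<phi> Q (s - 1) k w = norm_sum k (s - 1) w" for k w
      using that by (intro T_fun_eq_norm_sum) auto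
    moreover have "s - 1 - 1 = s - 2" "s - 1 + 1 = s" "1 \<le> s - 1" using that by auto
    ultimately show ?thesis
      using norm_sum_t_system[OF m, of "s - 1" u] by (simp only: T_fun_eq_norm_sum(2))
  qed
  \<comment> \<open>At colour \<open>s\<close> the index is twice the number of rows. The relation
    for \<open>n = s\<close> contains width \<open>s + 1\<close>, which the duality folds back to
    \<open>s\<close>.\<close>
  have "2 * m - 2 = 2 * (m - 1)" "2 * m + 2 = 2 * (m + 1)" by simp_all
  then show "T_fun s \<phi> Q s (2 * m) (u - 1) * T_fun s \<phi> Q s (2 * m) (u + 1) =
        T_fun s \<phi> Q s (2 * m - 2) u * T_fun s \<phi> Q s (2 * m + 2) u +
        g_fun s \<phi> s (2 * m) u * T_fun s \<phi> Q (s - 1) m u * T_fun s \<phi> Q s (2 * m) u"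
    using norm_sum_t_system[OF m s, of u] norm_sum_duality[of m u]
    by (simp only: T_fun_eq_norm_sum g_fun_T_fun_last)
qed

end

section \<open>Passing to meromorphic identities\<close>

text \<open>All arguments in the relations are integer translates of \<open>u\<close>. A finite
  window of them suffices, and finiteness is what lets the exceptional sets be united.\<close>

definition near :: "nat \<Rightarrow> complex \<Rightarrow> complex set" where
  "near B x = (\<lambda>e. x + of_int e) ` {- int B..int B}"

lemma nearI: "w = x + of_int e \<Longrightarrow> \<bar>e\<bar> \<le> int B \<Longrightarrow> w \<in> near B x"
  unfolding near_def by (rule image_eqI[of _ _ e]) auto

lemma near_subset:
  assumes "w = x + of_int e" "\<bar>e\<bar> + int B \<le> int C"
  shows "near B w \<subseteq> near C x"
proof
  fix y assume "y \<in> near B w"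
  then obtain d where "d \<in> {- int B..int B}" "y = w + of_int d"
    unfolding near_def by blast
  then show "y \<in> near C x" using assms by (intro nearI[of _ _ "e + d"]) auto
qed

definition agree_on ::
  "nat \<Rightarrow> (complex \<Rightarrow> complex) \<Rightarrow> (nat \<Rightarrow> complex \<Rightarrow> complex) \<Rightarrow>
   (complex \<Rightarrow> complex) \<Rightarrow> (nat \<Rightarrow> complex \<Rightarrow> complex) \<Rightarrow> complex set \<Rightarrow> bool" where
  "agree_on s \<phi> Q \<phi>' Q' S \<longleftrightarrow> (\<forall>w\<in>S. \<phi> w = \<phi>' w \<and> (\<forall>a\<le>s. Q a w = Q' a w))"

lemma agree_on_near:
  assumes "agree_on s \<phi> Q \<phi>' Q' (near C x)" "w = x + of_int e" "\<bar>e\<bar> + int B \<le> int C"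
  shows "agree_on s \<phi> Q \<phi>' Q' (near B w)"
  using assms(1) near_subset[OF assms(2,3)] unfolding agree_on_def by blast

lemma agree_onD:
  assumes "agree_on s \<phi> Q \<phi>' Q' (near B x)" "w = x + of_int e" "\<bar>e\<bar> \<le> int B"
  shows "\<phi> w = \<phi>' w" and "a \<le> s \<Longrightarrow> Q a w = Q' a w"
  using assms nearI[OF assms(2,3)] by (auto simp: agree_on_def)

text \<open>No argument in a box is shifted by more than \<open>2 s + 2\<close>; this radius and the
  ones below are rounded up.\<close>

lemma box_cong:
  assumes eq: "agree_on s \<phi> Q \<phi>' Q' (near (3 * s + 3) x)" and c: "c \<in> letters s"
  shows "box s \<phi> Q c x = box s \<phi>' Q' c x"
proof -
  note \<phi> = agree_onD(1)[OF eq] and Q = agree_onD(2)[OF eq]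
  have "\<phi> (x - 2) = \<phi>' (x - 2)" by (rule \<phi>[of _ "-2"]) simp_all
  moreover have "\<phi> (x - 2 * of_nat s - 1) = \<phi>' (x - 2 * of_nat s - 1)"
    by (rule \<phi>[of _ "- 2 * int s - 1"]) simp_all
  moreover have "\<phi> x = \<phi>' x" by (rule \<phi>[of _ 0]) simp_all
  moreover have "\<phi> (x - 2 * of_nat s + 1) = \<phi>' (x - 2 * of_nat s + 1)"
    by (rule \<phi>[of _ "- 2 * int s + 1"]) simp_all
  ultimately have psi: "psi s \<phi> c x = psi s \<phi>' c x"
    by (simp add: psi_def)
  show ?thesis
  proof (cases c)
    case (Pos a)
    then have a: "1 \<le> a" "a \<le> s" using c by (auto simp: letters_def)
    have "Q (a - 1) (x - of_nat a - 1) = Q' (a - 1) (x - of_nat a - 1)"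
      by (rule Q[of _ "- int a - 1"]) (use a in simp_all)
    moreover have "Q a (x - of_nat a + 2) = Q' a (x - of_nat a + 2)"
      by (rule Q[of _ "- int a + 2"]) (use a in simp_all)
    moreover have "Q (a - 1) (x - of_nat a + 1) = Q' (a - 1) (x - of_nat a + 1)"
      by (rule Q[of _ "- int a + 1"]) (use a in simp_all)
    moreover have "Q a (x - of_nat a) = Q' a (x - of_nat a)"
      by (rule Q[of _ "- int a"]) (use a in simp_all)
    ultimately show ?thesis using psi by (simp add: Pos)
  next
    case Zero
    have "Q s (x - of_nat s + 1) = Q' s (x - of_nat s + 1)"
      by (rule Q[of _ "- int s + 1"]) simp_all
    moreover have "Q s (x - of_nat s - 2) = Q' s (x - of_nat s - 2)"
      by (rule Q[of _ "- int s - 2"]) simp_all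
    moreover have "Q s (x - of_nat s - 1) = Q' s (x - of_nat s - 1)"
      by (rule Q[of _ "- int s - 1"]) simp_all
    moreover have "Q s (x - of_nat s) = Q' s (x - of_nat s)"
      by (rule Q[of _ "- int s"]) simp_all
    ultimately show ?thesis using psi by (simp add: Zero)
  next
    case (Bar a)
    then have a: "1 \<le> a" "a \<le> s" using c by (auto simp: letters_def)
    have "Q (a - 1) (x - 2 * of_nat s + of_nat a) = Q' (a - 1) (x - 2 * of_nat s + of_nat a)"
      by (rule Q[of _ "- 2 * int s + int a"]) (use a in simp_all)
    moreover have "Q a (x - 2 * of_nat s + of_nat a - 3) = Q' a (x - 2 * of_nat s + of_nat a - 3)"
      by (rule Q[of _ "- 2 * int s + int a - 3"]) (use a in simp_all)
    moreover have "Q (a - 1) (x - 2 * of_nat s + of_nat a - 2) = Q' (a - 1) (x - 2 * of_nat s + of_nat a - 2)"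
      by (rule Q[of _ "- 2 * int s + int a - 2"]) (use a in simp_all)
    moreover have "Q a (x - 2 * of_nat s + of_nat a - 1) = Q' a (x - 2 * of_nat s + of_nat a - 1)"
      by (rule Q[of _ "- 2 * int s + int a - 1"]) (use a in simp_all)
    ultimately show ?thesis using psi by (simp add: Bar)
  qed
qed

lemma norm_F_cong:
  assumes eq: "agree_on s \<phi> Q \<phi>' Q' (near (2 * s + n + 4) x)"
  shows "norm_F s \<phi> n x = norm_F s \<phi>' n x"
  unfolding norm_F_def
proof (intro prod.cong[OF refl] arg_cong2[where f = "(*)"])
  note \<phi> = agree_onD(1)[OF eq]
  fix j assume j: "j \<in> {1..<n}"
  show "\<phi> (x - of_nat n + 2 * of_nat j + 1) = \<phi>' (x - of_nat n + 2 * of_nat j + 1)"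
    by (rule \<phi>[of _ "- int n + 2 * int j + 1"]) (use j in auto)
  show "\<phi> (x - 2 * of_nat s - of_nat n + 2 * of_nat j - 2) = \<phi>' (x - 2 * of_nat s - of_nat n + 2 * of_nat j - 2)"
    by (rule \<phi>[of _ "- 2 * int s - int n + 2 * int j - 2"]) (use j in auto)
qed

lemma rect_T_norm_cong:
  assumes eq: "agree_on s \<phi> Q \<phi>' Q' (near (3 * s + m + n + 5) u)"
  shows "rect_T_norm s \<phi> Q m n u = rect_T_norm s \<phi>' Q' m n u"
proof -
  have "rect_T s \<phi> Q m n u = rect_T s \<phi>' Q' m n u"
    unfolding rect_T_def
  proof (intro sum.cong[OF refl] prod.cong[OF refl] arg_cong2[where f = "(*)"] refl)
    fix b i j assume b: "b \<in> fillings s m n" and i: "i \<in> {1..m}" and j: "j \<in> {1..n}"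
    have "b (i, j) \<in> letters s" using b i j by (auto simp: fillings_def PiE_iff)
    then show "box s \<phi> Q (b (i, j)) (u - of_nat n + of_nat m - 2 * of_nat i + 2 * of_nat j) =
      box s \<phi>' Q' (b (i, j)) (u - of_nat n + of_nat m - 2 * of_nat i + 2 * of_nat j)"
      by (intro box_cong agree_on_near[OF eq, of _ "- int n + int m - 2 * int i + 2 * int j"])
         (use i j in auto)
  qed
  moreover have "(\<Prod>j=1..m. norm_F s \<phi> n (u + of_nat m - 2 * of_nat j + 1)) =
      (\<Prod>j=1..m. norm_F s \<phi>' n (u + of_nat m - 2 * of_nat j + 1))"
  proof (intro prod.cong[OF refl] norm_F_cong)
    fix j assume j: "j \<in> {1..m}"
    show "agree_on s \<phi> Q \<phi>' Q' (near (2 * s + n + 4) (u + of_nat m - 2 * of_nat j + 1))"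
      by (rule agree_on_near[OF eq, of _ "int m - 2 * int j + 1"]) (use j in auto)
  qed
  ultimately show ?thesis by (simp add: rect_T_norm_def)
qed

lemma T_fun_cong:
  assumes eq: "agree_on s \<phi> Q \<phi>' Q' (near (4 * s + k + 5) u)"
  shows "T_fun s \<phi> Q a k u = T_fun s \<phi>' Q' a k u"
proof -
  have "rect_T_norm s \<phi> Q m n u = rect_T_norm s \<phi>' Q' m n u" if "m \<le> k" "n \<le> s" for m n
    by (rule rect_T_norm_cong, rule agree_on_near[OF eq, of _ 0]) (use that in auto)
  then show ?thesis by (auto simp: T_fun_def)
qed

lemma g_fun_cong:
  assumes eq: "agree_on s \<phi> Q \<phi>' Q' (near (4 * s + k + 5) u)"
  shows "g_fun s \<phi> b k u = g_fun s \<phi>' b k u"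
proof -
  have "T_zero s \<phi> (u + 2 * of_nat j - of_nat l - 1) = T_zero s \<phi>' (u + 2 * of_nat j - of_nat l - 1)"
    if "j \<in> {1..l}" "l \<le> k" for j l
  proof -
    have "agree_on s \<phi> Q \<phi>' Q' (near (2 * s + 2) (u + 2 * of_nat j - of_nat l - 1))"
      by (rule agree_on_near[OF eq, of _ "2 * int j - int l - 1"]) (use that in auto)
    note \<phi> = agree_onD(1)[OF this]
    show ?thesis
      unfolding T_zero_def
      by (intro arg_cong2[where f = "(*)"] \<phi>[of _ 1] \<phi>[of _ "- 2 * int s - 2"]) auto
  qed
  then have "(\<Prod>j=1..l. T_zero s \<phi> (u + 2 * of_nat j - of_nat l - 1)) =
      (\<Prod>j=1..l. T_zero s \<phi>' (u + 2 * of_nat j - of_nat l - 1))" if "l \<le> k" for l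
    using that by (intro prod.cong) auto
  from this[OF order_refl] this[OF div_le_dividend[of k 2]] show ?thesis
    by (simp only: g_fun_def)
qed

text \<open>Identity theorem: if the zeros of the translate accumulated anywhere, it would vanish
  identically, in particular at \<open>z - c\<close>.\<close>

lemma entire_nonzero_cosparse:
  assumes \<Phi>: "\<Phi> holomorphic_on UNIV" and nz: "\<Phi> z \<noteq> 0"
  shows "\<forall>\<^sub>\<approx>u. \<Phi> (u + c) \<noteq> 0"
proof -
  have hol: "(\<lambda>u. \<Phi> (u + c)) holomorphic_on UNIV"
    using holomorphic_on_compose_gen[OF _ \<Phi>, of "\<lambda>u. u + c" UNIV]
    by (simp add: o_def holomorphic_intros)
  have "\<not> y islimpt {u. \<Phi> (u + c) = 0}" for y
  proof
    assume "y islimpt {u. \<Phi> (u + c) = 0}"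
    then have "\<Phi> ((z - c) + c) = 0"
      by (rule analytic_continuation[OF hol open_UNIV connected_UNIV subset_UNIV UNIV_I, of y]) simp_all
    with nz show False by simp
  qed
  then show ?thesis by (simp add: eventually_cosparse sparse_in_open)
qed

text \<open>
  Since \<open>x / 0 = 0\<close>, the identities are proved for nowhere vanishing \<open>\<phi>\<close> and \<open>Q\<close>, at every \<open>u\<close>. For given
  functions the values at zeros are changed to 1; outside a sparse set of \<open>u\<close> this does not affect the
  finitely many values \<open>\<phi> (u + e)\<close> and \<open>Q a (u + e)\<close>, \<open>e\<close> an integer, that occur in the relations.
\<close>

definition replace_zeros :: "('a \<Rightarrow> complex) \<Rightarrow> 'a \<Rightarrow> complex" where
  "replace_zeros f x = (if f x = 0 then 1 else f x)"

lemma eventually_agree_on_replace_zeros: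
  assumes "\<And>c. \<forall>\<^sub>\<approx>u. \<phi> (u + c) \<noteq> 0" and "\<And>a c. a \<le> s \<Longrightarrow> \<forall>\<^sub>\<approx>u. Q a (u + c) \<noteq> 0"
  shows "\<forall>\<^sub>\<approx>u. agree_on s \<phi> Q (replace_zeros \<phi>) (\<lambda>a. replace_zeros (Q a)) (near B u)"
proof -
  have "\<forall>\<^sub>\<approx>u. \<forall>e\<in>{- int B..int B}. \<phi> (u + of_int e) \<noteq> 0 \<and> (\<forall>a\<in>{..s}. Q a (u + of_int e) \<noteq> 0)"
    using assms by (intro eventually_ball_finite ballI eventually_conj) auto
  then show ?thesis
    by (rule eventually_mono) (auto simp: agree_on_def near_def replace_zeros_def)
qed

theorem mainTheorem6:
  fixes s N :: nat
    and Nc :: "nat \<Rightarrow> nat"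
    and \<Phi> \<phi> :: "complex \<Rightarrow> complex"
    and w :: "nat \<Rightarrow> complex"
    and v :: "nat \<Rightarrow> nat \<Rightarrow> complex"
    and Q :: "nat \<Rightarrow> complex \<Rightarrow> complex"
  assumes "s \<ge> 1"
    and "\<Phi> holomorphic_on UNIV"
    and "\<exists>z. \<Phi> z \<noteq> 0"
    and "\<Phi> 0 = 0"
    and "\<And>u. \<phi> u = (\<Prod>j=1..N. \<Phi> (u - w j))"
    and "\<And>u. Q 0 u = 1"
    and "\<And>a u. 1 \<le> a \<Longrightarrow> a \<le> s \<Longrightarrow> Q a u = (\<Prod>j=1..Nc a. \<Phi> (u - v a j))"
  shows "\<forall>m\<ge>1.
     (\<forall>a. 1 \<le> a \<and> a + 2 \<le> s \<longrightarrow>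
        (\<forall>\<^sub>\<approx>u. T_fun s \<phi> Q a m (u - 1) * T_fun s \<phi> Q a m (u + 1) =
              T_fun s \<phi> Q a (m - 1) u * T_fun s \<phi> Q a (m + 1) u +
              g_fun s \<phi> a m u * T_fun s \<phi> Q (a - 1) m u * T_fun s \<phi> Q (a + 1) m u)) \<and>
     (s \<ge> 2 \<longrightarrow>
        (\<forall>\<^sub>\<approx>u. T_fun s \<phi> Q (s - 1) m (u - 1) * T_fun s \<phi> Q (s - 1) m (u + 1) =
              T_fun s \<phi> Q (s - 1) (m - 1) u * T_fun s \<phi> Q (s - 1) (m + 1) u +
              g_fun s \<phi> (s - 1) m u * T_fun s \<phi> Q (s - 2) m u * T_fun s \<phi> Q s (2 * m) u)) \<and>
     (\<forall>\<^sub>\<approx>u. T_fun s \<phi> Q s (2 * m) (u - 1) * T_fun s \<phi> Q s (2 * m) (u + 1) =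
           T_fun s \<phi> Q s (2 * m - 2) u * T_fun s \<phi> Q s (2 * m + 2) u +
           g_fun s \<phi> s (2 * m) u * T_fun s \<phi> Q (s - 1) m u * T_fun s \<phi> Q s (2 * m) u)"
proof -
  obtain z where z: "\<Phi> z \<noteq> 0" using assms(3) by blast
  have ev: "\<forall>\<^sub>\<approx>u. (\<Prod>j=1..k. \<Phi> (u + c - x j)) \<noteq> 0" for k c and x :: "nat \<Rightarrow> complex"
  proof -
    have "\<forall>\<^sub>\<approx>u. \<forall>j\<in>{1..k}. \<Phi> (u + (c - x j)) \<noteq> 0"
      using entire_nonzero_cosparse[OF assms(2) z] by (intro eventually_ball_finite) auto
    then show ?thesis
      by (rule eventually_mono) (auto simp: algebra_simps)
  qed
  have \<phi>: "\<forall>\<^sub>\<approx>u. \<phi> (u + c) \<noteq> 0" for c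
    using ev by (simp only: assms(5))
  have Q: "\<forall>\<^sub>\<approx>u. Q a (u + c) \<noteq> 0" if "a \<le> s" for a c
  proof (cases "a = 0")
    case True
    then show ?thesis using assms(6) by simp
  next
    case False
    then have "1 \<le> a" by simp
    then show ?thesis using ev that by (simp only: assms(7))
  qed
  let ?\<phi> = "replace_zeros \<phi>" and ?Q = "\<lambda>a. replace_zeros (Q a)"
  have ev_agree: "\<forall>\<^sub>\<approx>u. agree_on s \<phi> Q ?\<phi> ?Q (near B u)" for B
    using \<phi> Q by (rule eventually_agree_on_replace_zeros)
  \<comment> \<open>\<open>Q a\<close> is unconstrained for \<open>a > s\<close>; replacing zeros
    there as well gives the nonvanishing that the locale asks of every colour.\<close>
  interpret vacuum s ?\<phi> ?Q
    by unfold_locales (use assms(1,6) in \<open>auto simp: replace_zeros_def\<close>)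
  \<comment> \<open>The largest index is \<open>2 m + 2\<close>, from the third relation.
    \<open>T_fun_cong\<close> needs radius \<open>4 s + k + 5\<close>, and the arguments
    \<open>u - 1\<close> and \<open>u + 1\<close> cost one more, which makes
    \<open>4 s + 2 m + 8\<close>.\<close>
  have cong: "T_fun s \<phi> Q a k (u - 1) = T_fun s ?\<phi> ?Q a k (u - 1)"
      "T_fun s \<phi> Q a k u = T_fun s ?\<phi> ?Q a k u"
      "T_fun s \<phi> Q a k (u + 1) = T_fun s ?\<phi> ?Q a k (u + 1)"
      "g_fun s \<phi> b k u = g_fun s ?\<phi> b k u"
    if eq: "agree_on s \<phi> Q ?\<phi> ?Q (near (4 * s + 2 * m + 8) u)" and k: "k \<le> 2 * m + 2" for a b k m u
  proof -
    have near: "agree_on s \<phi> Q ?\<phi> ?Q (near (4 * s + k + 5) (u + of_int e))" if "\<bar>e\<bar> \<le> 1" for e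
      by (rule agree_on_near[OF eq refl]) (use that k in auto)
    show "T_fun s \<phi> Q a k (u - 1) = T_fun s ?\<phi> ?Q a k (u - 1)"
      "T_fun s \<phi> Q a k u = T_fun s ?\<phi> ?Q a k u"
      "T_fun s \<phi> Q a k (u + 1) = T_fun s ?\<phi> ?Q a k (u + 1)"
      "g_fun s \<phi> b k u = g_fun s ?\<phi> b k u"
      using near[of "-1"] near[of 0] near[of 1] by (simp_all add: T_fun_cong g_fun_cong)
  qed
  show ?thesis
  proof (intro allI impI conjI)
    fix m a :: nat assume m: "1 \<le> m" and a: "1 \<le> a \<and> a + 2 \<le> s"
    show "\<forall>\<^sub>\<approx>u. T_fun s \<phi> Q a m (u - 1) * T_fun s \<phi> Q a m (u + 1) =
              T_fun s \<phi> Q a (m - 1) u * T_fun s \<phi> Q a (m + 1) u +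
              g_fun s \<phi> a m u * T_fun s \<phi> Q (a - 1) m u * T_fun s \<phi> Q (a + 1) m u"
      using ev_agree[of "4 * s + 2 * m + 8"]
    proof (rule eventually_mono)
      fix u assume "agree_on s \<phi> Q ?\<phi> ?Q (near (4 * s + 2 * m + 8) u)"
      note c = cong[OF this]
      show "T_fun s \<phi> Q a m (u - 1) * T_fun s \<phi> Q a m (u + 1) =
              T_fun s \<phi> Q a (m - 1) u * T_fun s \<phi> Q a (m + 1) u +
              g_fun s \<phi> a m u * T_fun s \<phi> Q (a - 1) m u * T_fun s \<phi> Q (a + 1) m u"
        using t_system(1)[OF m, of a u] a by (simp add: c)
    qed
  next
    fix m :: nat assume m: "1 \<le> m" and s2: "2 \<le> s"
    show "\<forall>\<^sub>\<approx>u. T_fun s \<phi> Q (s - 1) m (u - 1) * T_fun s \<phi> Q (s - 1) m (u + 1) =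
              T_fun s \<phi> Q (s - 1) (m - 1) u * T_fun s \<phi> Q (s - 1) (m + 1) u +
              g_fun s \<phi> (s - 1) m u * T_fun s \<phi> Q (s - 2) m u * T_fun s \<phi> Q s (2 * m) u"
      using ev_agree[of "4 * s + 2 * m + 8"]
    proof (rule eventually_mono)
      fix u assume "agree_on s \<phi> Q ?\<phi> ?Q (near (4 * s + 2 * m + 8) u)"
      note c = cong[OF this]
      show "T_fun s \<phi> Q (s - 1) m (u - 1) * T_fun s \<phi> Q (s - 1) m (u + 1) =
              T_fun s \<phi> Q (s - 1) (m - 1) u * T_fun s \<phi> Q (s - 1) (m + 1) u +
              g_fun s \<phi> (s - 1) m u * T_fun s \<phi> Q (s - 2) m u * T_fun s \<phi> Q s (2 * m) u"
        using t_system(2)[OF m s2, of u] by (simp add: c)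
    qed
  next
    fix m :: nat assume m: "1 \<le> m"
    show "\<forall>\<^sub>\<approx>u. T_fun s \<phi> Q s (2 * m) (u - 1) * T_fun s \<phi> Q s (2 * m) (u + 1) =
           T_fun s \<phi> Q s (2 * m - 2) u * T_fun s \<phi> Q s (2 * m + 2) u +
           g_fun s \<phi> s (2 * m) u * T_fun s \<phi> Q (s - 1) m u * T_fun s \<phi> Q s (2 * m) u"
      using ev_agree[of "4 * s + 2 * m + 8"]
    proof (rule eventually_mono)
      fix u assume "agree_on s \<phi> Q ?\<phi> ?Q (near (4 * s + 2 * m + 8) u)"
      note c = cong[OF this]
      show "T_fun s \<phi> Q s (2 * m) (u - 1) * T_fun s \<phi> Q s (2 * m) (u + 1) =
           T_fun s \<phi> Q s (2 * m - 2) u * T_fun s \<phi> Q s (2 * m + 2) u +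
           g_fun s \<phi> s (2 * m) u * T_fun s \<phi> Q (s - 1) m u * T_fun s \<phi> Q s (2 * m) u"
        using t_system(3)[OF m, of u] by (simp add: c)
    qed
  qed
qed

end
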